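(* Let $q$ be a product proposal density on $\mathbb R^d$ with component-wise inverse-CDF map $\mathcal T$, $\bar\pi$ an unnormalized target density, $\omega=\bar\pi/q$, and $f:\mathbb R^d\to\mathbb R$ a test function, and let $\pi(f)$ and the RQMC-SNIS estimator $\pi_N(f)$ be as in the context, with RQMC point sets satisfying the RQMC assumption of the context. Assume that $\omega$ and $f$ satisfy the growth condition with growth rates $M_\omega\in\mathbb R$ and $M_f\in\mathbb R$, respectively. (i) If $\max\{M_\omega,M_\omega+M_f\}<0$, then for any $p\ge1$, $$\Big\{\mathbb E_{\mathrm{RQMC}}\big|\pi_N(f)-\pi(f)\big|^p\Big\}^{1/p}=\mathcal O\big(N^{-1}(\log N)^{d-1}\big).$$ (ii) Suppose that there exists a constant $v>1$ such that $q(|f|^v)=\int_{\mathbb R^d}|f(\bm x)|^vq(\bm x)\,d\bm x<\infty$, and let $1\le p<v$. If $M_\omega>0$ can be taken arbitrarily small (i.e. for every $M>0$, $\omega$ satisfies the growth condition with growth rate $M$), $q\in\mathrm{SG}(\eta,\alpha)$ for some $\eta\in\mathbb Z$ and $\alpha>0$, and $0\le M_f<\alpha/p$, then for any $\epsilon>0$, $$\Big\{\mathbb E_{\mathrm{RQMC}}\big|\pi_N(f)-\pi(f)\big|^p\Big\}^{1/p}=\mathcal O\big(N^{-1+pM_f/\alpha+\epsilon}\big).$$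
   Context: Notation: $\|\cdot\|$ is the Euclidean norm; for $\bm a\in\mathbb N_0^d$, $|\bm a|=a_1+\dots+a_d$ and $D^{\bm a}$ is the corresponding partial derivative. Growth condition with growth rate $M\in\mathbb R$ for a function $g:\mathbb R^d\to\mathbb R$: $g\in C^d(\mathbb R^d)$ and there is a constant $C>0$ (which may depend on $M$) such that $|D^{\bm a}g(\bm x)|\le C\exp\{M\|\bm x\|^2\}$ for all $\bm x\in\mathbb R^d$ and all $\bm a\in\mathbb N_0^d$ with $|\bm a|\le d$. Density and transport: $q(\bm x)=\prod_{j=1}^d q_j(x_j)$, where each $q_j$ is a probability density on $\mathbb R$ that is strictly positive and continuous. $\mathcal T(\bm u)=(\mathcal T_1(u_1),\dots,\mathcal T_d(u_d))$ for $\bm u\in(0,1)^d$, where $\mathcal T_j:(0,1)\to\mathbb R$ is the inverse of the cumulative distribution function of $q_j$. Target: $\bar\pi:\mathbb R^d\to[0,\infty)$ is an unnormalized probability density, $0<\int\bar\pi<\infty$; $\omega=\bar\pi/q$; and $\pi(f)=\frac{\int f(\bm x)\bar\pi(\bm x)\,d\bm x}{\int\bar\pi(\bm x)\,d\bm x}=\frac{q(\omega f)}{q(\omega)}$, where $q(g)=\int_{\mathbb R^d}g(\bm x)q(\bm x)\,d\bm x$. RQMC-SNIS estimator: with $\bm x_i=\mathcal T(\bm u_i)$, $$\pi_N(f)=\frac{\frac1N\sum_{i=1}^N\omega(\bm x_i)f(\bm x_i)}{\frac1N\sum_{j=1}^N\omega(\bm x_j)},$$ with the convention that $\pi_N(f)=0$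 if the denominator vanishes. Sub-Gaussian-type tail: for $\eta\in\mathbb Z$, $\alpha>0$, $q\in\mathrm{SG}(\eta,\alpha)$ means $\limsup_{t\to\infty}t^{-\eta}\exp(\alpha t^2)\,\mathbb P_q(\|\bm X\|>t)<\infty$, where $\bm X\sim q$. RQMC assumption: for each sample size $N$ (ranging over an infinite set of admissible integers $N\ge2$), $\bm u_1,\dots,\bm u_N$ are random points in $(0,1)^d$ (not necessarily independent) such that (1) each $\bm u_i$ is marginally uniformly distributed on $(0,1)^d$; (2) there is a constant $B_d>0$ independent of $N$ such that, with probability one, $D_N^*(\bm u_1,\dots,\bm u_N)\le B_d\frac{(\log N)^{d-1}}{N}$, where $D_N^*(\bm u_1,\dots,\bm u_N)=\sup_{\bm z\in(0,1)^d}\big|\frac1N\sum_{i=1}^N\mathbf 1\{\bm u_i\in[\bm 0,\bm z)\}-\prod_{j=1}^d z_j\big|$ is the star discrepancy. $\mathbb E_{\mathrm{RQMC}}$ is expectation over the randomness of the points. $\mathcal O(\cdot)$ is meant as $N\to\infty$ along admissible $N$, with implicit constant independent of $N$ (it may depend on everything else). *)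

theory Defs
  imports "HOL-Probability.Probability" "HOL-Library.Landau_Symbols"
begin

definition partial_deriv :: "'d \<Rightarrow> (real ^ 'd \<Rightarrow> real) \<Rightarrow> real ^ 'd \<Rightarrow> real" where
  "partial_deriv i g x = deriv (\<lambda>t. g (x + t *\<^sub>R axis i 1)) 0"

text \<open>Functions of class \<open>C\<^sup>k\<close> on the whole space: all iterated partial derivatives up to
  order \<open>k\<close>, in every order of differentiation, exist everywhere and are continuous.\<close>

primrec C_k :: "nat \<Rightarrow> (real ^ 'd \<Rightarrow> real) \<Rightarrow> bool" where
  "C_k 0 g \<longleftrightarrow> continuous_on UNIV g"
| "C_k (Suc k) g \<longleftrightarrow> continuous_on UNIV g \<and>
     (\<forall>i. (\<forall>x. (\<lambda>t. g (x + t *\<^sub>R axis i 1)) field_differentiable at 0) \<and>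
          C_k k (partial_deriv i g))"

text \<open>The index type carries no order, so an arbitrary but fixed enumeration of the coordinates
  plays the role of \<open>1, \<dots>, d\<close>. For functions of class \<open>C\<^sup>k\<close> with \<open>k\<close> at least the order of the
  derivative, the choice is irrelevant by the symmetry of mixed partial derivatives.\<close>

definition coord_list :: "'d::finite list" where
  "coord_list = (SOME xs. distinct xs \<and> set xs = UNIV)"

lemma distinct_coord_list: "distinct (coord_list :: 'd::finite list)"
  and set_coord_list: "set (coord_list :: 'd::finite list) = UNIV"
proof -
  have "\<exists>xs. distinct xs \<and> set xs = (UNIV :: 'd set)"
    using finite_distinct_list[of "UNIV :: 'd set"] by auto
  from someI_ex[OF this] show "distinct (coord_list :: 'd list)" "set (coord_list :: 'd list) = UNIV"
    unfolding coord_list_def by auto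
qed

definition mixed_partial ::
  "('d::finite \<Rightarrow> nat) \<Rightarrow> (real ^ 'd \<Rightarrow> real) \<Rightarrow> real ^ 'd \<Rightarrow> real" where
  "mixed_partial a g = foldr (\<lambda>i. partial_deriv i ^^ a i) coord_list g"

definition growth_condition :: "real \<Rightarrow> (real ^ 'd::finite \<Rightarrow> real) \<Rightarrow> bool" where
  "growth_condition M g \<longleftrightarrow> C_k CARD('d) g \<and>
     (\<exists>C>0. \<forall>x. \<forall>a :: 'd \<Rightarrow> nat. (\<Sum>j\<in>UNIV. a j) \<le> CARD('d) \<longrightarrow>
        \<bar>mixed_partial a g x\<bar> \<le> C * exp (M * (norm x)\<^sup>2))"

definition positive_continuous_density :: "(real \<Rightarrow> real) \<Rightarrow> bool" where
  "positive_continuous_density \<rho> \<longleftrightarrow>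
     (\<forall>x. 0 < \<rho> x) \<and> continuous_on UNIV \<rho> \<and> has_bochner_integral lborel \<rho> 1"

definition product_density :: "('d::finite \<Rightarrow> real \<Rightarrow> real) \<Rightarrow> real ^ 'd \<Rightarrow> real" where
  "product_density qs x = (\<Prod>j\<in>UNIV. qs j (x $ j))"

text \<open>Meaningful only on \<open>open_unit_cube\<close>: for positive continuous densities the cumulative
  distribution functions are bijections onto the open unit interval.\<close>

definition transport :: "('d::finite \<Rightarrow> real \<Rightarrow> real) \<Rightarrow> real ^ 'd \<Rightarrow> real ^ 'd" where
  "transport qs u = (\<chi> j. the_inv (cdf (density lborel (\<lambda>x. ennreal (qs j x)))) (u $ j))"

definition open_unit_cube :: "(real ^ 'd) set" where
  "open_unit_cube = {u. \<forall>j. 0 < u $ j \<and> u $ j < 1}"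

definition star_discrepancy :: "nat \<Rightarrow> (nat \<Rightarrow> real ^ 'd::finite) \<Rightarrow> real" where
  "star_discrepancy N u =
     (SUP z \<in> open_unit_cube.
        \<bar>1 / real N * (\<Sum>i=1..N. indicator {x. \<forall>j. 0 \<le> x $ j \<and> x $ j < z $ j} (u i))
         - (\<Prod>j\<in>UNIV. z $ j)\<bar>)"

text \<open>\<open>A\<close> is the set of admissible sample sizes and \<open>u N i\<close>, for \<open>1 \<le> i \<le> N\<close>, is the \<open>i\<close>-th
  point of the point set of size \<open>N\<close>; different sample sizes may live on different
  probability spaces.\<close>

definition rqmc_points ::
  "nat set \<Rightarrow> (nat \<Rightarrow> 'w measure) \<Rightarrow> (nat \<Rightarrow> nat \<Rightarrow> 'w \<Rightarrow> real ^ 'd::finite) \<Rightarrow> bool" where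
  "rqmc_points A P u \<longleftrightarrow>
     infinite A \<and> (\<forall>N\<in>A. 2 \<le> N) \<and>
     (\<forall>N\<in>A. prob_space (P N)) \<and>
     (\<forall>N\<in>A. \<forall>i\<in>{1..N}. u N i \<in> borel_measurable (P N) \<and>
        (\<forall>s\<in>space (P N). u N i s \<in> open_unit_cube) \<and>
        distr (P N) borel (u N i) = uniform_measure lborel open_unit_cube) \<and>
     (\<exists>B>0. \<forall>N\<in>A. AE s in P N.
        star_discrepancy N (\<lambda>i. u N i s) \<le> B * (ln (real N) ^ (CARD('d) - 1) / real N))"

definition target_expectation :: "(real ^ 'd::finite \<Rightarrow> real) \<Rightarrow> (real ^ 'd \<Rightarrow> real) \<Rightarrow> real" where
  "target_expectation \<pi>' f = (LINT x|lborel. f x * \<pi>' x) / (LINT x|lborel. \<pi>' x)"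

definition snis_estimator ::
  "('x \<Rightarrow> real) \<Rightarrow> ('x \<Rightarrow> real) \<Rightarrow> nat \<Rightarrow> (nat \<Rightarrow> 'x) \<Rightarrow> real" where
  "snis_estimator w f N x =
     (if 1 / real N * (\<Sum>j=1..N. w (x j)) = 0 then 0
      else (1 / real N * (\<Sum>i=1..N. w (x i) * f (x i))) / (1 / real N * (\<Sum>j=1..N. w (x j))))"

definition sub_gaussian_tail :: "(real ^ 'd::finite \<Rightarrow> real) \<Rightarrow> int \<Rightarrow> real \<Rightarrow> bool" where
  "sub_gaussian_tail q \<eta> \<alpha> \<longleftrightarrow>
     Limsup at_top (\<lambda>t :: real. ereal (t powi (- \<eta>) * exp (\<alpha> * t\<^sup>2) *
       measure (density lborel (\<lambda>x. ennreal (q x))) {x. norm x > t})) < \<infinity>"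

text \<open>The error bound \<open>{E|X\<^sub>N|\<^sup>p}\<^sup>1\<^sup>/\<^sup>p = O(r N)\<close> along \<open>N \<in> A\<close>. Finiteness of the moment for large
  \<open>N\<close> is part of the claim and is stated explicitly, because the Bochner integral of a
  non-integrable function is \<open>0\<close>.\<close>

definition Lp_rate ::
  "real \<Rightarrow> nat set \<Rightarrow> (nat \<Rightarrow> 'w measure) \<Rightarrow> (nat \<Rightarrow> 'w \<Rightarrow> real) \<Rightarrow> (nat \<Rightarrow> real) \<Rightarrow> bool" where
  "Lp_rate p A P X r \<longleftrightarrow>
     (\<forall>\<^sub>F N in inf sequentially (principal A). integrable (P N) (\<lambda>s. \<bar>X N s\<bar> powr p)) \<and>
     (\<lambda>N. (LINT s|P N. \<bar>X N s\<bar> powr p) powr (1 / p)) \<in> O[inf sequentially (principal A)](r)"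

end

theory Submission
  imports Defs
begin

text \<open>
  Write \<open>\<partial>\<^sub>S g\<close> for the mixed partial derivative that differentiates once in each coordinate of \<open>S\<close>.
  If all \<open>\<partial>\<^sub>S g\<close> are bounded by multiples of a Gaussian, then \<open>g(x)\<close> equals, up to sign, the
  integral of the full mixed partial derivative of \<open>g\<close> over the orthant above \<open>x\<close>. Averaging over the
  sample points and subtracting the mean under \<open>q\<close> produces the local discrepancy of the points
  \<open>u\<^sub>i\<close> at \<open>F(y)\<close>, where \<open>F\<close> is the vector of marginal distribution functions, so the integration error
  is at most a constant times the star discrepancy. Applied to \<open>\<omega>\<close> and \<open>\<omega> f\<close>, this gives (i).
  For (ii), \<open>g = \<omega>\<close> or \<open>g = \<omega> f\<close> is multiplied by a smooth cutoff to the ball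
  \<open>\<parallel>x\<parallel>\<^sup>2 \<le> \<rho>\<close>. The cutoff has to be radial: on a cube the bound \<open>exp (M \<parallel>x\<parallel>\<^sup>2)\<close> would be too large.
  The discarded part is at most \<open>exp (- (\<alpha> / p - M) \<rho>)\<close> times a function with finite \<open>p\<close>-th moment,
  and \<open>\<rho> = (p / \<alpha>) ln N\<close> balances both errors. Because \<open>\<omega> \<ge> 0\<close>, the denominator is bounded below by the
  average of a truncated \<open>\<omega>\<close>, which converges almost surely at a deterministic rate.
\<close>

section \<open>Families of mixed partial derivatives\<close>

text \<open>Coordinates are only ever differentiated in the order of \<^const>\<open>coord_list\<close>, last one first, so
  that symmetry of mixed partial derivatives is not needed.\<close>

definition mixed_family :: "('d::finite set \<Rightarrow> real ^ 'd \<Rightarrow> real) \<Rightarrow> bool" where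
  "mixed_family G \<longleftrightarrow> (\<forall>S. continuous_on UNIV (G S)) \<and>
     (\<forall>xs i ys S x. coord_list = xs @ i # ys \<longrightarrow> S \<subseteq> set ys \<longrightarrow>
        ((\<lambda>t. G S (x + t *\<^sub>R axis i 1)) has_real_derivative G (insert i S) x) (at 0))"

text \<open>The family is existentially quantified, so that products and cutoffs may exhibit their
  derivatives by explicit formulas. The constant \<open>C\<close> is a parameter because its growth
  with the cutoff radius decides the rate in (ii).\<close>

definition mixed_bound :: "real \<Rightarrow> real \<Rightarrow> (real ^ 'd::finite \<Rightarrow> real) \<Rightarrow> bool" where
  "mixed_bound M C g \<longleftrightarrow>
     (\<exists>G. mixed_family G \<and> G {} = g \<and> (\<forall>S x. \<bar>G S x\<bar> \<le> C * exp (M * (norm x)\<^sup>2)))"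

lemma coord_list_split:
  fixes S :: "'d::finite set"
  assumes "coord_list = xs @ i # ys" "S \<subseteq> set ys"
  shows "i \<notin> S"
proof -
  have "distinct (xs @ i # ys)" using distinct_coord_list[where 'd='d] assms(1) by simp
  then show ?thesis using assms(2) by auto
qed

lemma mixed_bound_continuous: "mixed_bound M C g \<Longrightarrow> continuous_on UNIV g"
  unfolding mixed_bound_def mixed_family_def by auto

lemma mixed_bound_abs_le: "mixed_bound M C g \<Longrightarrow> \<bar>g x\<bar> \<le> C * exp (M * (norm x)\<^sup>2)"
  unfolding mixed_bound_def by auto

lemma mixed_bound_mono:
  assumes "mixed_bound M C g" "M \<le> M'" "C \<le> C'" "0 \<le> C'"
  shows "mixed_bound M' C' g"
proof -
  from assms(1) obtain G where G: "mixed_family G" "G {} = g"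
    "\<And>S x. \<bar>G S x\<bar> \<le> C * exp (M * (norm x)\<^sup>2)"
    unfolding mixed_bound_def by blast
  have "\<bar>G S x\<bar> \<le> C' * exp (M' * (norm x)\<^sup>2)" for S x
    by (rule order_trans[OF G(3)], rule mult_mono) (use assms in \<open>auto intro!: mult_right_mono\<close>)
  with G show ?thesis unfolding mixed_bound_def by blast
qed

lemma C_k_foldr_partial_deriv:
  "C_k n g \<Longrightarrow> length l \<le> n \<Longrightarrow> C_k (n - length l) (foldr partial_deriv l g)"
proof (induction l)
  case (Cons i l)
  then have "C_k (Suc (n - length (i # l))) (foldr partial_deriv l g)"
    by (simp add: Suc_diff_le flip: Suc_diff_Suc)
  then show ?case by simp
qed simp

lemma C_k_imp_continuous: "C_k n g \<Longrightarrow> continuous_on UNIV g"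
  by (cases n) auto

text \<open>The derivative over \<open>S\<close> is \<open>mixed_partial\<close> for the 0-1
  multi-index of \<open>S\<close>, whose order is at most the dimension. Filtering
  \<open>coord_list\<close> by \<open>S\<close> keeps the order in which
  \<open>mixed_partial\<close> differentiates.\<close>

lemma growth_condition_imp_mixed_bound:
  fixes g :: "real ^ 'd::finite \<Rightarrow> real"
  assumes "growth_condition M g"
  obtains C where "0 < C" "mixed_bound M C g"
proof -
  from assms obtain C where Ck: "C_k CARD('d) g" and C: "C > 0" and
    bnd: "\<And>x a. (\<Sum>j\<in>UNIV. a j) \<le> CARD('d) \<Longrightarrow> \<bar>mixed_partial a g x\<bar> \<le> C * exp (M * (norm x)\<^sup>2)"
    unfolding growth_condition_def by blast
  define F where "F S = filter (\<lambda>i. i \<in> S) (coord_list :: 'd list)" for S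
  define G where "G S = foldr partial_deriv (F S) g" for S
  have lenF: "length (F S) = card S" for S
  proof -
    have "distinct (F S)" "set (F S) = S"
      unfolding F_def using distinct_coord_list[where 'd='d] set_coord_list[where 'd='d] by auto
    then show ?thesis by (metis distinct_card)
  qed
  have card_le: "card S \<le> CARD('d)" for S :: "'d set" by (simp add: card_mono)
  have CG: "C_k (CARD('d) - card S) (G S)" for S
    using C_k_foldr_partial_deriv[OF Ck, of "F S"] lenF[of S] card_le[of S] unfolding G_def by simp
  have bG: "\<bar>G S x\<bar> \<le> C * exp (M * (norm x)\<^sup>2)" for S x
  proof -
    let ?a = "\<lambda>i. if i \<in> S then 1 else (0::nat)"
    have "foldr (\<lambda>i. partial_deriv i ^^ ?a i) l g = foldr partial_deriv (filter (\<lambda>i. i \<in> S) l) g" for l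
      by (induction l) auto
    then have "mixed_partial ?a g = G S" unfolding mixed_partial_def G_def F_def by simp
    moreover have "(\<Sum>j\<in>UNIV. ?a j) \<le> CARD('d)" using card_le[of S] by (simp add: sum.If_cases)
    ultimately show ?thesis using bnd[of ?a x] by simp
  qed
  have "((\<lambda>t. G S (x + t *\<^sub>R axis i 1)) has_real_derivative G (insert i S) x) (at 0)"
    if cl: "coord_list = xs @ i # ys" and S: "S \<subseteq> set ys" for xs i ys S x
  proof -
    have d: "distinct (xs @ i # ys)" using distinct_coord_list[where 'd='d] cl by simp
    have xsS: "filter (\<lambda>j. j \<in> S) xs = []" "filter (\<lambda>j. j = i \<or> j \<in> S) xs = []"
      using d S by (auto simp: filter_empty_conv)
    have iS: "i \<notin> S" using d S by auto
    have "filter (\<lambda>j. j = i \<or> j \<in> S) ys = filter (\<lambda>j. j \<in> S) ys"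
      by (rule filter_cong) (use d in auto)
    \<comment> \<open>All of \<open>S\<close> lies after \<open>i\<close> in the list, so the
      derivative in \<open>i\<close> is the outermost one.\<close>
    then have "F (insert i S) = i # F S" unfolding F_def cl using xsS iS by simp
    then have "G (insert i S) = partial_deriv i (G S)" unfolding G_def by simp
    \<comment> \<open>\<open>G S\<close> must have one order of differentiability left. As
      \<open>i\<close> is not in \<open>S\<close>, fewer than \<open>CARD('d)\<close> orders have
      been spent.\<close>
    moreover have "\<exists>k. CARD('d) - card S = Suc k"
    proof -
      have "card (insert i S) \<le> CARD('d)" by (rule card_le)
      then have "card S < CARD('d)" using iS by simp
      then show ?thesis by (metis Suc_diff_Suc)
    qed
    then have "(\<lambda>t. G S (x + t *\<^sub>R axis i 1)) field_differentiable at 0"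
      using CG[of S] by auto
    ultimately show ?thesis
      by (simp add: partial_deriv_def DERIV_deriv_iff_field_differentiable)
  qed
  moreover have "continuous_on UNIV (G S)" for S using C_k_imp_continuous[OF CG] .
  ultimately have "mixed_family G" unfolding mixed_family_def by blast
  moreover have "G {} = g" unfolding G_def F_def by simp
  ultimately have "mixed_bound M C g" using bG unfolding mixed_bound_def by blast
  with C show ?thesis by (rule that)
qed

text \<open>Leibniz rule for derivatives that hit each coordinate at most once: the derivative over
  \<open>S\<close> is a sum over all ways to split \<open>S\<close> between the two factors, of
  which there are at most \<open>2 ^ CARD('d)\<close>.\<close>

lemma mixed_bound_mult:
  fixes g h :: "real ^ 'd::finite \<Rightarrow> real"
  assumes "mixed_bound M C g" "mixed_bound M' C' h" "0 \<le> C" "0 \<le> C'"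
  shows "mixed_bound (M + M') (2 ^ CARD('d) * C * C') (\<lambda>x. g x * h x)"
proof -
  from assms obtain G where G: "mixed_family G" "G {} = g"
    "\<And>S x. \<bar>G S x\<bar> \<le> C * exp (M * (norm x)\<^sup>2)" unfolding mixed_bound_def by blast
  from assms obtain K where K: "mixed_family K" "K {} = h"
    "\<And>S x. \<bar>K S x\<bar> \<le> C' * exp (M' * (norm x)\<^sup>2)" unfolding mixed_bound_def by blast
  define H where "H S x = (\<Sum>T\<in>Pow S. G T x * K (S - T) x)" for S x
  have cont: "continuous_on UNIV (H S)" for S
    unfolding H_def using G(1) K(1) unfolding mixed_family_def
    by (intro continuous_intros) auto
  have deriv: "((\<lambda>t. H S (x + t *\<^sub>R axis i 1)) has_real_derivative H (insert i S) x) (at 0)"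
    if cl: "coord_list = xs @ i # ys" and S: "S \<subseteq> set ys" for xs i ys S x
  proof -
    have iS: "i \<notin> S" using coord_list_split[OF cl S] .
    have dG: "((\<lambda>t. G T (x + t *\<^sub>R axis i 1)) has_real_derivative G (insert i T) x) (at 0)"
      and dK: "((\<lambda>t. K T (x + t *\<^sub>R axis i 1)) has_real_derivative K (insert i T) x) (at 0)"
      if "T \<subseteq> S" for T
      using G(1) K(1) cl S that unfolding mixed_family_def by (meson order_trans)+
    have "((\<lambda>t. H S (x + t *\<^sub>R axis i 1)) has_real_derivative
        (\<Sum>T\<in>Pow S. G (insert i T) x * K (S - T) x + K (insert i (S - T)) x * G T x)) (at 0)"
      unfolding H_def
    proof (rule DERIV_sum)
      fix T assume "T \<in> Pow S"
      then have "T \<subseteq> S" by simp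
      from DERIV_mult[OF dG[OF this] dK[of "S - T"]]
      show "((\<lambda>t. G T (x + t *\<^sub>R axis i 1) * K (S - T) (x + t *\<^sub>R axis i 1)) has_real_derivative
        G (insert i T) x * K (S - T) x + K (insert i (S - T)) x * G T x) (at 0)"
        by auto
    qed
    moreover have "(\<Sum>T\<in>Pow S. G (insert i T) x * K (S - T) x + K (insert i (S - T)) x * G T x)
        = H (insert i S) x"
    proof -
      have fin: "finite S" by simp
      \<comment> \<open>Subsets without \<open>i\<close> are the terms in which the new derivative
        falls on \<open>K\<close>; subsets containing \<open>i\<close> are those in which it falls
        on \<open>G\<close>.\<close>
      have "H (insert i S) x = (\<Sum>T\<in>Pow S. G T x * K (insert i S - T) x) +
          (\<Sum>T\<in>insert i ` Pow S. G T x * K (insert i S - T) x)"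
        unfolding H_def Pow_insert by (rule sum.union_disjoint) (use iS fin in auto)
      also have "(\<Sum>T\<in>insert i ` Pow S. G T x * K (insert i S - T) x)
          = (\<Sum>T\<in>Pow S. G (insert i T) x * K (insert i S - insert i T) x)"
        by (subst sum.reindex) (use iS in \<open>auto intro!: inj_onI simp: insert_ident\<close>)
      also have "\<dots> = (\<Sum>T\<in>Pow S. G (insert i T) x * K (S - T) x)"
        by (rule sum.cong) (use iS in \<open>auto simp: insert_Diff_if\<close>)
      also have "(\<Sum>T\<in>Pow S. G T x * K (insert i S - T) x) = (\<Sum>T\<in>Pow S. K (insert i (S - T)) x * G T x)"
        by (rule sum.cong) (use iS in \<open>auto simp: insert_Diff_if\<close>)
      finally show ?thesis by (simp add: sum.distrib)
    qed
    ultimately show ?thesis by simp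
  qed
  have bnd: "\<bar>H S x\<bar> \<le> 2 ^ CARD('d) * C * C' * exp ((M + M') * (norm x)\<^sup>2)" for S x
  proof -
    have "\<bar>H S x\<bar> \<le> (\<Sum>T\<in>Pow S. \<bar>G T x\<bar> * \<bar>K (S - T) x\<bar>)"
      unfolding H_def by (rule order_trans[OF sum_abs]) (simp add: abs_mult)
    also have "\<dots> \<le> (\<Sum>T\<in>Pow S. (C * exp (M * (norm x)\<^sup>2)) * (C' * exp (M' * (norm x)\<^sup>2)))"
      by (intro sum_mono mult_mono G K) (use assms in auto)
    also have "\<dots> = 2 ^ card S * (C * C' * exp ((M + M') * (norm x)\<^sup>2))"
      by (simp add: card_Pow exp_add algebra_simps)
    also have "\<dots> \<le> 2 ^ CARD('d) * (C * C' * exp ((M + M') * (norm x)\<^sup>2))"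
      by (intro mult_right_mono power_increasing card_mono) (use assms in auto)
    finally show ?thesis by (simp add: mult.assoc)
  qed
  have "mixed_family H" unfolding mixed_family_def using cont deriv by blast
  moreover have "H {} = (\<lambda>x. g x * h x)" unfolding H_def using G(2) K(2) by auto
  ultimately show ?thesis using bnd unfolding mixed_bound_def by blast
qed

section \<open>Smooth steps and radial cutoffs\<close>

text \<open>Finitely many derivatives suffice, since a mixed derivative has order at most the
  dimension; they are carried as a sequence starting with the step itself. The transition zone has
  length \<open>k + 1\<close> because the construction starts from a ramp of length 1 and each
  averaging widens it by 1.\<close>

definition smooth_step :: "nat \<Rightarrow> (nat \<Rightarrow> real \<Rightarrow> real) \<Rightarrow> bool" where
  "smooth_step k \<psi> \<longleftrightarrow>
    (\<forall>j<k. \<forall>s. (\<psi> j has_real_derivative \<psi> (Suc j) s) (at s)) \<and>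
    (\<forall>j\<le>k. continuous_on UNIV (\<psi> j)) \<and> (\<forall>j\<le>k. \<exists>b. \<forall>s. \<bar>\<psi> j s\<bar> \<le> b) \<and>
    (\<forall>j\<le>k. \<forall>s\<ge>real k + 1. \<psi> j s = 0) \<and> (\<forall>s\<le>0. \<psi> 0 s = 1) \<and>
    (\<forall>s. 0 \<le> \<psi> 0 s) \<and> (\<forall>s. \<psi> 0 s \<le> 1)"

lemma smooth_stepD:
  assumes "smooth_step k \<psi>"
  shows "\<And>j s. j < k \<Longrightarrow> (\<psi> j has_real_derivative \<psi> (Suc j) s) (at s)"
    "\<And>j. j \<le> k \<Longrightarrow> continuous_on UNIV (\<psi> j)" "\<And>j. j \<le> k \<Longrightarrow> \<exists>b. \<forall>s. \<bar>\<psi> j s\<bar> \<le> b"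
    "\<And>j s. j \<le> k \<Longrightarrow> s \<ge> real k + 1 \<Longrightarrow> \<psi> j s = 0"
    "\<And>s. s \<le> 0 \<Longrightarrow> \<psi> 0 s = 1" "\<And>s. 0 \<le> \<psi> 0 s" "\<And>s. \<psi> 0 s \<le> 1"
  using assms unfolding smooth_step_def by simp_all

text \<open>Averaging a step over intervals of length \<open>1\<close> gains one order of smoothness.\<close>

lemma smooth_step_exists: "\<exists>\<psi>. smooth_step k \<psi>"
proof (induction k)
  case 0
  have "\<exists>b. \<forall>s. \<bar>max 0 (min 1 (1 - s :: real))\<bar> \<le> b" by (rule exI[of _ 1]) auto
  then have "smooth_step 0 (\<lambda>_ s. max 0 (min 1 (1 - s)))"
    unfolding smooth_step_def by (auto intro!: continuous_intros)
  then show ?case by blast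
next
  case (Suc k)
  then obtain \<psi> where "smooth_step k \<psi>" by blast
  note \<psi> = smooth_stepD[OF this]
  have c0: "continuous_on X (\<psi> 0)" for X using \<psi>(2)[of 0] continuous_on_subset by blast
  then have int: "\<psi> 0 integrable_on {a..b}" for a b by (rule integrable_continuous_real)
  \<comment> \<open>The moving average of \<open>\<psi> 0\<close> has derivative
    \<open>\<psi> 0 s - \<psi> 0 (s - 1)\<close>, so all further derivatives are differences of the
    old ones, with the index shifted by one.\<close>
  define \<phi> where "\<phi> j = (case j of 0 \<Rightarrow> (\<lambda>s. integral {s - 1..s} (\<psi> 0)) | Suc i \<Rightarrow> (\<lambda>s. \<psi> i s - \<psi> i (s - 1)))" for j
  have d0: "(\<phi> 0 has_real_derivative \<phi> (Suc 0) s) (at s)" for s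
  proof -
    \<comment> \<open>Near \<open>s\<close> the moving average is a difference of two integrals with
      the same fixed lower end. The end \<open>s - 2\<close> lies below \<open>t - 1\<close> for all
      \<open>t\<close> in the neighbourhood \<open>{s - 1<..<s + 1}\<close>.\<close>
    let ?J = "\<lambda>t. integral {s - 2..t} (\<psi> 0)"
    have J: "(?J has_real_derivative \<psi> 0 t) (at t)" if "s - 2 < t" "t < s + 1" for t
    proof -
      have "(?J has_real_derivative \<psi> 0 t) (at t within {s - 2..s + 1})"
        using integral_has_real_derivative[OF c0] that by simp
      moreover have "at t within {s - 2..s + 1} = at t"
        by (rule at_within_interior) (use that in simp)
      ultimately show ?thesis by simp
    qed
    have "((\<lambda>t. ?J (t - 1)) has_real_derivative \<psi> 0 (s - 1)) (at s)"
      by (rule DERIV_chain2[OF J, where g="\<lambda>t. t - 1" and Db=1, simplified]) (auto intro!: derivative_eq_intros)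
    then have "((\<lambda>t. ?J t - ?J (t - 1)) has_real_derivative \<psi> 0 s - \<psi> 0 (s - 1)) (at s)"
      by (intro DERIV_diff J) auto
    moreover have "\<forall>\<^sub>F t in nhds s. \<phi> 0 t = ?J t - ?J (t - 1)"
    proof -
      have "\<forall>\<^sub>F t in nhds s. t \<in> {s - 1<..<s + 1}" by (rule eventually_nhds_in_open) auto
      then show ?thesis
      proof eventually_elim
        case (elim t)
        then show ?case
          using Henstock_Kurzweil_Integration.integral_combine[of "s - 2" "t - 1" t "\<psi> 0"] int
          by (simp add: \<phi>_def)
      qed
    qed
    ultimately show ?thesis
      by (subst DERIV_cong_ev[OF refl _ refl]) (auto simp: \<phi>_def)
  qed
  have dS: "(\<phi> j has_real_derivative \<phi> (Suc j) s) (at s)" if "j < Suc k" for j s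
  proof (cases j)
    case 0 then show ?thesis using d0 by simp
  next
    case (Suc i)
    then have i: "i < k" using that by simp
    have "((\<lambda>t. \<psi> i (t - 1)) has_real_derivative \<psi> (Suc i) (s - 1)) (at s)"
      by (rule DERIV_chain2[OF \<psi>(1)[OF i], where g="\<lambda>t. t - 1" and Db=1, simplified]) (auto intro!: derivative_eq_intros)
    then show ?thesis unfolding Suc \<phi>_def by (auto intro!: DERIV_diff \<psi>(1) i)
  qed
  have cS: "continuous_on UNIV (\<phi> j)" if "j \<le> Suc k" for j
  proof (cases j)
    case 0
    then show ?thesis using d0 by (intro continuous_at_imp_continuous_on) (auto intro: DERIV_isCont)
  next
    case (Suc i)
    then have "continuous_on UNIV (\<psi> i)" using that \<psi>(2) by simp
    then show ?thesis unfolding Suc \<phi>_def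
      by (auto intro!: continuous_intros intro: continuous_on_compose2[of UNIV "\<psi> i"])
  qed
  have r0: "0 \<le> \<phi> 0 s \<and> \<phi> 0 s \<le> 1" for s
  proof -
    have "integral {s - 1..s} (\<psi> 0) \<ge> 0" by (rule integral_nonneg[OF int]) (use \<psi> in auto)
    moreover have "integral {s - 1..s} (\<psi> 0) \<le> integral {s - 1..s} (\<lambda>_. 1)"
      by (rule integral_le[OF int]) (use \<psi> in auto)
    ultimately show ?thesis by (simp add: \<phi>_def)
  qed
  have bS: "\<exists>b. \<forall>s. \<bar>\<phi> j s\<bar> \<le> b" if "j \<le> Suc k" for j
  proof (cases j)
    case 0 then show ?thesis using r0 by (auto intro!: exI[of _ 1])
  next
    case (Suc i)
    then have "i \<le> k" using that by simp
    then obtain b where b: "\<And>s. \<bar>\<psi> i s\<bar> \<le> b" using \<psi>(3)[of i] by blast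
    have "\<bar>\<psi> i s - \<psi> i (s - 1)\<bar> \<le> b + b" for s using b[of s] b[of "s - 1"] by linarith
    then show ?thesis unfolding Suc \<phi>_def by auto
  qed
  have zS: "\<phi> j s = 0" if "j \<le> Suc k" "s \<ge> real (Suc k) + 1" for j s
  proof (cases j)
    case 0
    have "integral {s - 1..s} (\<psi> 0) = integral {s - 1..s} (\<lambda>_. 0)"
      by (rule integral_cong) (use that \<psi>(4)[of 0] in auto)
    then show ?thesis by (simp add: \<phi>_def 0)
  next
    case (Suc i) then show ?thesis using that \<psi>(4)[of i] by (simp add: \<phi>_def)
  qed
  have oS: "\<phi> 0 s = 1" if "s \<le> 0" for s
  proof -
    have "integral {s - 1..s} (\<psi> 0) = integral {s - 1..s} (\<lambda>_. 1)"
      by (rule integral_cong) (use that \<psi>(5) in auto)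
    then show ?thesis by (simp add: \<phi>_def)
  qed
  have "smooth_step (Suc k) \<phi>"
    unfolding smooth_step_def by (intro conjI allI impI dS cS bS zS oS) (simp_all add: r0)
  then show ?case by blast
qed

text \<open>This product is what the chain rule extracts from the squared norm. Its polynomial
  growth is absorbed by a Gaussian of arbitrarily small positive rate, coordinate by coordinate,
  through \<open>2 * \<bar>t\<bar> \<le> 1 + t\<^sup>2\<close>.\<close>

lemma abs_prod_le_exp:
  fixes x :: "real ^ 'd::finite"
  assumes "0 < \<delta>"
  shows "\<bar>\<Prod>j\<in>S. 2 * x $ j\<bar> \<le> max 1 (1 / \<delta>) ^ CARD('d) * exp (\<delta> * (norm x)\<^sup>2)"
proof -
  let ?c = "max 1 (1 / \<delta>)"
  have *: "\<bar>2 * t\<bar> \<le> ?c * exp (\<delta> * t\<^sup>2)" for t :: real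
  proof -
    have "0 \<le> (\<bar>t\<bar> - 1)\<^sup>2" by simp
    then have "\<bar>2 * t\<bar> \<le> 1 + t\<^sup>2" by (simp add: power2_diff abs_mult)
    also have "\<dots> \<le> ?c + ?c * (\<delta> * t\<^sup>2)"
    proof -
      have "1 \<le> ?c * \<delta>" using assms by (simp add: max_def field_simps)
      then have "1 * t\<^sup>2 \<le> (?c * \<delta>) * t\<^sup>2" by (rule mult_right_mono) simp
      then show ?thesis by (simp add: mult.assoc)
    qed
    also have "\<dots> = ?c * (1 + \<delta> * t\<^sup>2)" by (simp add: distrib_left)
    also have "\<dots> \<le> ?c * exp (\<delta> * t\<^sup>2)" by (intro mult_left_mono exp_ge_add_one_self) auto
    finally show ?thesis .
  qed
  have "\<bar>\<Prod>j\<in>S. 2 * x $ j\<bar> = (\<Prod>j\<in>S. \<bar>2 * x $ j\<bar>)" by (simp add: abs_prod)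
  also have "\<dots> \<le> (\<Prod>j\<in>S. ?c * exp (\<delta> * (x $ j)\<^sup>2))"
    by (rule prod_mono) (use * in auto)
  also have "\<dots> = ?c ^ card S * exp (\<Sum>j\<in>S. \<delta> * (x $ j)\<^sup>2)"
    by (simp add: prod.distrib exp_sum)
  also have "\<dots> \<le> ?c ^ CARD('d) * exp (\<delta> * (norm x)\<^sup>2)"
  proof (rule mult_mono)
    have "(\<Sum>j\<in>S. \<delta> * (x $ j)\<^sup>2) \<le> (\<Sum>j\<in>UNIV. \<delta> * (x $ j)\<^sup>2)"
      by (rule sum_mono2) (use assms in auto)
    also have "\<dots> = \<delta> * (norm x)\<^sup>2"
      by (simp add: norm_vec_def L2_set_def sum_nonneg sum_distrib_left)
    finally show "exp (\<Sum>j\<in>S. \<delta> * (x $ j)\<^sup>2) \<le> exp (\<delta> * (norm x)\<^sup>2)" by simp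
    show "?c ^ card S \<le> ?c ^ CARD('d)" by (intro power_increasing card_mono) auto
  qed auto
  finally show ?thesis .
qed

text \<open>A smooth step is composed with \<open>(norm x)\<^sup>2 - \<rho>\<close>. As no
  coordinate is differentiated twice, the derivative over \<open>S\<close> is just the product of
  the \<open>2 * x $ j\<close> times the derivative of the step of order \<open>card S\<close>. On
  the support the squared norm exceeds \<open>\<rho>\<close> by a bounded amount only, so any
  Gaussian decay rate \<open>m\<close> can be bought at the price
  \<open>exp ((m + \<delta>) * \<rho>)\<close>, where \<open>\<delta>\<close> pays for the product.
  The constant \<open>B\<close> is uniform in \<open>\<rho>\<close>.\<close>

lemma radial_cutoff_exists:
  "\<exists>\<kappa> :: real \<Rightarrow> real ^ 'd::finite \<Rightarrow> real.
     (\<forall>\<rho> x. 0 \<le> \<kappa> \<rho> x \<and> \<kappa> \<rho> x \<le> 1) \<and> (\<forall>\<rho> x. (norm x)\<^sup>2 \<le> \<rho> \<longrightarrow> \<kappa> \<rho> x = 1) \<and>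
     (\<forall>m\<ge>0. \<forall>\<delta>>0. \<exists>B>0. \<forall>\<rho>. mixed_bound (- m) (B * exp ((m + \<delta>) * \<rho>)) (\<kappa> \<rho>))"
proof -
  let ?d = "CARD('d)"
  obtain \<psi> where "smooth_step ?d \<psi>" using smooth_step_exists by blast
  note \<psi> = smooth_stepD[OF this]
  obtain b where b: "\<And>j s. j \<le> ?d \<Longrightarrow> \<bar>\<psi> j s\<bar> \<le> b j" using \<psi>(3) by metis
  define b' where "b' = Max (insert 1 (b ` {..?d}))"
  have b': "\<bar>\<psi> j s\<bar> \<le> b'" if "j \<le> ?d" for j s
  proof -
    have "b j \<le> b'" unfolding b'_def by (rule Max_ge) (use that in auto)
    then show ?thesis using b[OF that, of s] by linarith
  qed
  have b'1: "1 \<le> b'" unfolding b'_def by simp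
  define \<kappa> where "\<kappa> \<rho> x = \<psi> 0 ((norm x)\<^sup>2 - \<rho>)" for \<rho> and x :: "real ^ 'd"
  have card_le: "card S \<le> ?d" for S :: "'d set" by (simp add: card_mono)
  have "\<exists>B>0. \<forall>\<rho>. mixed_bound (- m) (B * exp ((m + \<delta>) * \<rho>)) (\<kappa> \<rho>)" if m: "0 \<le> m" and \<delta>: "0 < \<delta>" for m \<delta>
  proof -
    define c where "c = max 1 (1 / \<delta>) ^ ?d"
    have c: "0 < c" unfolding c_def by simp
    \<comment> \<open>The last factor pays for the transition zone, where the squared norm reaches
      up to \<open>\<rho> + real ?d + 1\<close>.\<close>
    define B where "B = b' * c * exp ((m + \<delta>) * (real ?d + 1))"
    have "B > 0" unfolding B_def using b'1 c by simp
    moreover have "mixed_bound (- m) (B * exp ((m + \<delta>) * \<rho>)) (\<kappa> \<rho>)" for \<rho>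
    proof -
      define \<Psi> where "\<Psi> S x = (\<Prod>j\<in>S. 2 * x $ j) * \<psi> (card S) ((norm x)\<^sup>2 - \<rho>)" for S and x :: "real ^ 'd"
      have cont: "continuous_on UNIV (\<Psi> S)" for S unfolding \<Psi>_def
        by (intro continuous_intros continuous_on_compose2[OF \<psi>(2)[OF card_le]]) auto
      have deriv: "((\<lambda>t. \<Psi> S (x + t *\<^sub>R axis i 1)) has_real_derivative \<Psi> (insert i S) x) (at 0)"
        if iS: "i \<notin> S" for i S x
      proof -
        have "card (insert i S) \<le> ?d" by (rule card_le)
        then have cS: "card S < ?d" using iS by simp
        have n: "(norm (x + t *\<^sub>R axis i 1))\<^sup>2 = (norm x)\<^sup>2 + 2 * x $ i * t + t\<^sup>2" for t
          unfolding power2_norm_eq_inner inner_add_left inner_add_right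
          by (simp add: inner_axis inner_axis' power2_eq_square)
        have p: "(\<Prod>j\<in>S. 2 * (x + t *\<^sub>R axis i 1) $ j) = (\<Prod>j\<in>S. 2 * x $ j)" for t
          by (rule prod.cong) (use iS in \<open>auto simp: axis_def\<close>)
        let ?h = "\<lambda>t. (norm x)\<^sup>2 + 2 * x $ i * t + t\<^sup>2 - \<rho>"
        have "(?h has_real_derivative 2 * x $ i) (at 0)"
          by (rule derivative_eq_intros refl | simp)+
        moreover have "(\<psi> (card S) has_real_derivative \<psi> (Suc (card S)) (?h 0)) (at (?h 0))"
          by (rule \<psi>(1)[OF cS])
        ultimately have "((\<lambda>t. \<psi> (card S) (?h t)) has_real_derivative
           \<psi> (Suc (card S)) (?h 0) * (2 * x $ i)) (at 0)"
          by (rule DERIV_chain2[rotated])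
        from DERIV_cmult[OF this, of "\<Prod>j\<in>S. 2 * x $ j"]
        show ?thesis unfolding \<Psi>_def n p using iS by (simp add: mult_ac)
      qed
      have bnd: "\<bar>\<Psi> S x\<bar> \<le> B * exp ((m + \<delta>) * \<rho>) * exp (- m * (norm x)\<^sup>2)" for S x
      proof (cases "(norm x)\<^sup>2 - \<rho> \<ge> real ?d + 1")
        case True
        then have "\<Psi> S x = 0" unfolding \<Psi>_def using \<psi>(4)[OF card_le] by simp
        then show ?thesis using \<open>B > 0\<close> by simp
      next
        case False
        have "\<bar>\<Psi> S x\<bar> \<le> (c * exp (\<delta> * (norm x)\<^sup>2)) * b'"
          unfolding \<Psi>_def abs_mult c_def
          by (intro mult_mono abs_prod_le_exp b' card_le \<delta>) auto
        \<comment> \<open>The growing factor is split off so that it can be bounded by its value at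
          the edge of the support; the factor with rate \<open>- m\<close> is kept as the
          decay.\<close>
        also have "\<dots> = b' * c * (exp ((m + \<delta>) * (norm x)\<^sup>2) * exp (- m * (norm x)\<^sup>2))"
        proof -
          have "exp (\<delta> * (norm x)\<^sup>2) = exp ((m + \<delta>) * (norm x)\<^sup>2) * exp (- m * (norm x)\<^sup>2)"
            unfolding exp_add[symmetric] by (simp add: distrib_right)
          then show ?thesis by simp
        qed
        also have "\<dots> \<le> b' * c * (exp ((m + \<delta>) * (real ?d + 1 + \<rho>)) * exp (- m * (norm x)\<^sup>2))"
          by (intro mult_left_mono mult_right_mono) (use False m \<delta> b'1 c in auto)
        also have "\<dots> = B * exp ((m + \<delta>) * \<rho>) * exp (- m * (norm x)\<^sup>2)"
          unfolding B_def distrib_left[of "m + \<delta>"] exp_add by simp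
        finally show ?thesis .
      qed
      have "mixed_family \<Psi>" unfolding mixed_family_def
      proof (intro conjI allI impI cont deriv)
        fix xs ys :: "'d list" and i S
        assume "coord_list = xs @ i # ys" "S \<subseteq> set ys"
        then show "i \<notin> S" by (rule coord_list_split)
      qed
      moreover have "\<Psi> {} = \<kappa> \<rho>" unfolding \<Psi>_def \<kappa>_def by auto
      ultimately show ?thesis using bnd unfolding mixed_bound_def by blast
    qed
    ultimately show ?thesis by blast
  qed
  moreover have "0 \<le> \<kappa> \<rho> x \<and> \<kappa> \<rho> x \<le> 1" for \<rho> x unfolding \<kappa>_def using \<psi> by blast
  moreover have "\<kappa> \<rho> x = 1" if "(norm x)\<^sup>2 \<le> \<rho>" for \<rho> x unfolding \<kappa>_def using \<psi>(5) that by simp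
  ultimately show ?thesis by blast
qed

section \<open>Integral representation and a Koksma--Hlawka inequality\<close>

lemma integrable_exp_neg_square:
  assumes "0 < m"
  shows "integrable lborel (\<lambda>t::real. exp (- m * t\<^sup>2))"
proof -
  define \<sigma> where "\<sigma> = sqrt (1 / (2 * m))"
  have \<sigma>: "0 < \<sigma>" "2 * \<sigma>\<^sup>2 = 1 / m" using assms by (simp_all add: \<sigma>_def)
  have "integrable lborel (\<lambda>t. sqrt (2 * pi * \<sigma>\<^sup>2) * normal_density 0 \<sigma> t)"
    using integrable_normal_moment[OF \<sigma>(1), of 0 0] by simp
  also have "(\<lambda>t. sqrt (2 * pi * \<sigma>\<^sup>2) * normal_density 0 \<sigma> t) = (\<lambda>t. exp (- m * t\<^sup>2))"
    using \<sigma> by (auto simp: normal_density_def fun_eq_iff)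
  finally show ?thesis .
qed

lemma Basis_vec_real: "(Basis :: (real ^ 'd::finite) set) = (\<lambda>j. axis j 1) ` UNIV"
  unfolding Basis_vec_def by auto

lemma inj_axis_one: "inj_on (\<lambda>j. axis j (1::real)) (S :: 'd::finite set)"
  by (auto intro!: inj_onI simp: axis_eq_axis)

lemma norm_vec_square: "(norm (x :: real ^ 'd::finite))\<^sup>2 = (\<Sum>j\<in>UNIV. (x $ j)\<^sup>2)"
  by (simp add: norm_vec_def L2_set_def sum_nonneg)

lemma vec_update_eq:
  fixes z :: "real ^ 'd::finite"
  shows "(\<chi> j. if j = i then t else z $ j) = z + (t - z $ i) *\<^sub>R axis i 1"
  by (auto simp: vec_eq_iff axis_def)

text \<open>Fundamental theorem of calculus along coordinate \<open>i\<close> on the half-line above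
  \<open>z $ i\<close>. The boundary term at infinity vanishes by the Gaussian bound, which leaves
  only the minus sign.\<close>

lemma mixed_family_line_integral:
  fixes G :: "'d::finite set \<Rightarrow> real ^ 'd \<Rightarrow> real"
  assumes G: "mixed_family G" and bnd: "\<And>S x. \<bar>G S x\<bar> \<le> C * exp (- m * (norm x)\<^sup>2)" and m: "0 < m"
    and cl: "coord_list = xs @ i # ys" and S: "S \<subseteq> set ys"
  shows "G S z = - (\<integral>t. indicator {z $ i<..} t * G (insert i S) (\<chi> j. if j = i then t else z $ j) \<partial>lborel)"
proof -
  let ?u = "\<lambda>t. \<chi> j. if j = i then t else z $ j"
  let ?F = "\<lambda>t. G S (?u t)" and ?f = "\<lambda>t. G (insert i S) (?u t)"
  have C: "0 \<le> C" using bnd[of S 0] by simp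
  have u_cont: "continuous_on UNIV ?u" unfolding vec_update_eq by (intro continuous_intros)
  have G_cont: "continuous_on UNIV (G T)" for T using G unfolding mixed_family_def by blast
  have c: "continuous_on UNIV (\<lambda>t. G T (?u t))" for T
    by (rule continuous_on_compose2[OF G_cont u_cont]) auto
  have isc: "isCont (\<lambda>t. G T (?u t)) t" for T t using c[of T] by (simp add: continuous_on_eq_continuous_at)
  have le: "\<bar>G T (?u t)\<bar> \<le> C * exp (- m * t\<^sup>2)" for T t
  proof -
    have "t\<^sup>2 = (?u t $ i)\<^sup>2" by simp
    also have "\<dots> \<le> (norm (?u t))\<^sup>2" unfolding norm_vec_square by (rule member_le_sum) auto
    finally have "- m * (norm (?u t))\<^sup>2 \<le> - m * t\<^sup>2" using m by simp
    then show ?thesis using C by (intro order_trans[OF bnd] mult_left_mono) auto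
  qed
  have deriv: "(?F has_real_derivative ?f t) (at t)" for t
  proof -
    have "((\<lambda>s. G S (?u t + s *\<^sub>R axis i 1)) has_real_derivative ?f t) (at 0)"
      using G cl S unfolding mixed_family_def by blast
    moreover have "?u t + s *\<^sub>R axis i 1 = ?u (s + t)" for s
      by (auto simp: vec_eq_iff axis_def)
    ultimately have "((\<lambda>s. ?F (s + t)) has_real_derivative ?f t) (at 0)" by simp
    then show ?thesis using DERIV_shift[of ?F "?f t" 0 t] by simp
  qed
  have gauss: "integrable lborel (\<lambda>t. C * exp (- m * t\<^sup>2))"
    using integrable_exp_neg_square[OF m] by simp
  have int: "integrable lborel ?f"
  proof (rule Bochner_Integration.integrable_bound[OF gauss])
    show "?f \<in> borel_measurable lborel" using borel_measurable_continuous_onI[OF c] by simp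
  qed (use le C in auto)
  have top: "(?F \<longlongrightarrow> 0) at_top"
  proof (rule Lim_null_comparison)
    show "\<forall>\<^sub>F t in at_top. norm (?F t) \<le> C * exp (- m * t\<^sup>2)" using le by simp
    have "((\<lambda>t. exp (- (m * t\<^sup>2))) \<longlongrightarrow> 0) at_top"
      by (intro filterlim_compose[OF exp_at_bot] filterlim_compose[OF filterlim_uminus_at_bot_at_top]
          filterlim_tendsto_pos_mult_at_top[OF tendsto_const m] filterlim_pow_at_top filterlim_ident) auto
    then show "((\<lambda>t. C * exp (- m * t\<^sup>2)) \<longlongrightarrow> 0) at_top"
      using tendsto_mult[OF tendsto_const, of _ 0 at_top C] by fastforce
  qed
  have "(LBINT t=ereal (z $ i)..\<infinity>. ?f t) = 0 - ?F (z $ i)"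
  proof (rule interval_integral_FTC_integrable)
    show "(?F has_vector_derivative ?f t) (at t)" for t
      using deriv by (simp add: has_real_derivative_iff_has_vector_derivative)
    show "set_integrable lborel (einterval (ereal (z $ i)) \<infinity>) ?f"
      using int by (intro integrable_mult_indicator[where f="?f", folded set_integrable_def]) auto
    show "((?F \<circ> real_of_ereal) \<longlongrightarrow> ?F (z $ i)) (at_right (ereal (z $ i)))"
      using isc[where T=S and t="z $ i"] unfolding ereal_tendsto_simps
      by (auto simp: isCont_def intro: tendsto_mono[OF at_le])
    show "((?F \<circ> real_of_ereal) \<longlongrightarrow> 0) (at_left \<infinity>)"
      unfolding ereal_tendsto_simps by (rule top)
  qed (use isc in auto)
  moreover have "?u (z $ i) = z" by (simp add: vec_eq_iff)
  ultimately show ?thesis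
    by (simp add: interval_integral_to_infinity_eq set_lebesgue_integral_def)
qed

text \<open>Induction over suffixes of \<open>coord_list\<close>: coordinates in \<open>ys\<close>
  are integrated out, the others stay frozen at \<open>z\<close>. Each step applies the line
  integral in the coordinate that precedes \<open>ys\<close>, as \<open>mixed_family\<close>
  demands. The product measure is indexed by the vectors \<open>axis j 1\<close> because
  \<open>lborel\<close> is the image of a product over \<open>Basis\<close>.\<close>

lemma mixed_family_multiple_integral:
  fixes G :: "'d::finite set \<Rightarrow> real ^ 'd \<Rightarrow> real"
  assumes G: "mixed_family G" and bnd: "\<And>S x. \<bar>G S x\<bar> \<le> C * exp (- m * (norm x)\<^sup>2)" and m: "0 < m"
    and "coord_list = xs @ ys"
  shows "G {} z = (- 1) ^ length ys * (\<integral>y. (\<Prod>j\<in>set ys. indicator {z $ j<..} (y (axis j 1))) *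
      G (set ys) (\<chi> j. if j \<in> set ys then y (axis j 1) else z $ j)
      \<partial>Pi\<^sub>M ((\<lambda>j. axis j 1) ` set ys) (\<lambda>_ :: real ^ 'd. lborel))"
  using assms(4)
proof (induction ys arbitrary: xs)
  case Nil
  have "space (Pi\<^sub>M {} (\<lambda>_ :: real ^ 'd. lborel :: real measure)) = {\<lambda>_. undefined}"
    by (simp add: space_PiM)
  then show ?case by (simp add: PiM_empty lebesgue_integral_count_space_finite)
next
  case (Cons i ys)
  interpret product_sigma_finite "\<lambda>_ :: real ^ 'd. lborel :: real measure" by standard
  let ?E = "\<lambda>S. (\<lambda>j :: 'd. axis j (1 :: real)) ` S"
  let ?mix = "\<lambda>S y. \<chi> j. if j \<in> S then y (axis j 1) else z $ j"
  let ?f = "\<lambda>S y. (\<Prod>j\<in>S. indicator {z $ j<..} (y (axis j 1))) * G S (?mix S y)"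
  have C: "0 \<le> C" using bnd[of "{}" 0] by simp
  have i: "i \<notin> set ys" using coord_list_split[OF Cons.prems, of "set ys"] by simp
  have G_cont: "continuous_on UNIV (G T)" for T using G unfolding mixed_family_def by blast
  have iE: "axis i 1 \<notin> ?E (set ys)" using i by (auto simp: axis_eq_axis)
  have mix_meas: "?mix S \<in> borel_measurable (Pi\<^sub>M (?E S) (\<lambda>_. lborel))" for S
  proof -
    have "(\<lambda>y. ?mix S y \<bullet> b) \<in> borel_measurable (Pi\<^sub>M (?E S) (\<lambda>_. lborel))"
      if "b \<in> Basis" for b
    proof -
      from that have "b \<in> (\<lambda>j. axis j 1) ` UNIV" unfolding Basis_vec_real .
      then obtain k where k: "b = axis k 1" by blast
      show ?thesis
      proof (cases "k \<in> S")
        case True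
        then have "(\<lambda>y. y (axis k 1)) \<in> measurable (Pi\<^sub>M (?E S) (\<lambda>_. lborel :: real measure)) lborel"
          by (intro measurable_component_singleton) auto
        then show ?thesis using True by (simp add: k inner_axis)
      qed (simp add: k inner_axis)
    qed
    then show ?thesis by (subst borel_measurable_euclidean_space) blast
  qed
  have f_meas: "?f S \<in> borel_measurable (Pi\<^sub>M (?E S) (\<lambda>_. lborel))" for S
  proof (rule borel_measurable_times)
    show "(\<lambda>y. G S (?mix S y)) \<in> borel_measurable (Pi\<^sub>M (?E S) (\<lambda>_. lborel))"
      by (rule measurable_compose[OF mix_meas borel_measurable_continuous_onI[OF G_cont]])
    have "(\<lambda>y. y (axis k 1)) \<in> measurable (Pi\<^sub>M (?E S) (\<lambda>_. lborel :: real measure)) borel" if "k \<in> S" for k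
      using measurable_component_singleton[of "axis k 1" "?E S" "\<lambda>_. lborel :: real measure"] that by simp
    moreover have "(indicator {z $ k<..} :: real \<Rightarrow> real) \<in> borel_measurable borel" for k by simp
    ultimately show "(\<lambda>y. \<Prod>j\<in>S. indicator {z $ j<..} (y (axis j 1)) :: real)
        \<in> borel_measurable (Pi\<^sub>M (?E S) (\<lambda>_. lborel))"
      by (intro borel_measurable_prod) (rule measurable_compose)
  qed
  \<comment> \<open>Frozen coordinates only enlarge the norm, so a product of one-dimensional
    Gaussians in the integrated coordinates dominates.\<close>
  have f_int: "integrable (Pi\<^sub>M (?E S) (\<lambda>_. lborel)) (?f S)" for S
  proof (rule Bochner_Integration.integrable_bound[OF _ f_meas])
    show "integrable (Pi\<^sub>M (?E S) (\<lambda>_. lborel)) (\<lambda>y. C * (\<Prod>b\<in>?E S. exp (- m * (y b)\<^sup>2)))"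
      using integrable_exp_neg_square[OF m] by (intro integrable_mult_right product_integrable_prod) auto
    have "\<bar>?f S y\<bar> \<le> C * (\<Prod>b\<in>?E S. exp (- m * (y b)\<^sup>2))" for y
    proof -
      have "(\<Sum>j\<in>S. (y (axis j 1))\<^sup>2) = (\<Sum>j\<in>S. (?mix S y $ j)\<^sup>2)" by (rule sum.cong) auto
      also have "\<dots> \<le> (norm (?mix S y))\<^sup>2" unfolding norm_vec_square by (rule sum_mono2) auto
      finally have n: "(\<Sum>j\<in>S. (y (axis j 1))\<^sup>2) \<le> (norm (?mix S y))\<^sup>2" .
      have "\<bar>(\<Prod>j\<in>S. indicator {z $ j<..} (y (axis j 1)) :: real)\<bar> \<le> 1"
        unfolding abs_prod by (rule prod_le_1) (auto simp: indicator_def)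
      then have "\<bar>?f S y\<bar> \<le> 1 * (C * exp (- m * (norm (?mix S y))\<^sup>2))"
        unfolding abs_mult by (intro mult_mono bnd) auto
      also have "\<dots> \<le> C * exp (- m * (\<Sum>j\<in>S. (y (axis j 1))\<^sup>2))"
        using n m C by (auto intro!: mult_left_mono)
      also have "exp (- m * (\<Sum>j\<in>S. (y (axis j 1))\<^sup>2)) = (\<Prod>j\<in>S. exp (- m * (y (axis j 1))\<^sup>2))"
        by (simp add: exp_sum sum_distrib_left flip: sum_negf)
      also have "\<dots> = (\<Prod>b\<in>?E S. exp (- m * (y b)\<^sup>2))"
        by (simp add: prod.reindex[OF inj_axis_one])
      finally show ?thesis .
    qed
    then show "AE y in Pi\<^sub>M (?E S) (\<lambda>_. lborel). norm (?f S y) \<le> norm (C * (\<Prod>b\<in>?E S. exp (- m * (y b)\<^sup>2)))"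
      using C by (simp add: prod_nonneg)
  qed
  \<comment> \<open>The line integral is taken at the partly integrated point
    \<open>?mix (set ys) y\<close>, whose coordinate \<open>i\<close> is still \<open>z $ i\<close>.
    The indicators over \<open>ys\<close> do not depend on \<open>t\<close> and move
    outside.\<close>
  have step: "?f (set ys) y = - (\<integral>t. ?f (insert i (set ys)) (y(axis i 1 := t)) \<partial>lborel)" for y :: "real ^ 'd \<Rightarrow> real"
  proof -
    let ?p = "(\<Prod>j\<in>set ys. indicator {z $ j<..} (y (axis j 1))) :: real"
    have a: "y(axis i 1 := t) = (\<lambda>b. if b = axis i 1 then t else y b)" for t by auto
    have e: "?f (insert i (set ys)) (y(axis i 1 := t)) =
        ?p * (indicator {z $ i<..} t * G (insert i (set ys)) (\<chi> j. if j = i then t else ?mix (set ys) y $ j))" for t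
    proof -
      have "(\<Prod>j\<in>set ys. indicator {z $ j<..} ((y(axis i 1 := t)) (axis j 1))) = ?p"
        by (rule prod.cong) (use i in \<open>auto simp: axis_eq_axis\<close>)
      moreover have "?mix (insert i (set ys)) (y(axis i 1 := t)) = (\<chi> j. if j = i then t else ?mix (set ys) y $ j)"
        by (rule vec_eq_iff[THEN iffD2]) (simp add: axis_eq_axis)
      ultimately show ?thesis using i by (simp only: prod.insert finite_set fun_upd_same) simp
    qed
    have "G (set ys) (?mix (set ys) y) = - (\<integral>t. indicator {?mix (set ys) y $ i<..} t *
        G (insert i (set ys)) (\<chi> j. if j = i then t else ?mix (set ys) y $ j) \<partial>lborel)"
      by (rule mixed_family_line_integral[OF G bnd m Cons.prems]) simp
    also have "?mix (set ys) y $ i = z $ i" using i by simp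
    finally show ?thesis unfolding e by simp
  qed
  have "G {} z = (- 1) ^ length ys * (\<integral>y. ?f (set ys) y \<partial>Pi\<^sub>M (?E (set ys)) (\<lambda>_. lborel))"
    using Cons.IH[of "xs @ [i]"] Cons.prems by simp
  also have "(\<integral>y. ?f (set ys) y \<partial>Pi\<^sub>M (?E (set ys)) (\<lambda>_. lborel)) =
     - (\<integral>y. (\<integral>t. ?f (insert i (set ys)) (y(axis i 1 := t)) \<partial>lborel) \<partial>Pi\<^sub>M (?E (set ys)) (\<lambda>_. lborel))"
    unfolding step by simp
  also have "(\<integral>y. (\<integral>t. ?f (insert i (set ys)) (y(axis i 1 := t)) \<partial>lborel) \<partial>Pi\<^sub>M (?E (set ys)) (\<lambda>_. lborel)) =
     (\<integral>y. ?f (insert i (set ys)) y \<partial>Pi\<^sub>M (?E (insert i (set ys))) (\<lambda>_. lborel))"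
    unfolding image_insert
    by (rule product_integral_insert[symmetric]) (use f_int[of "insert i (set ys)"] iE in auto)
  finally show ?case by simp
qed

text \<open>The suffix is now all of \<open>coord_list\<close>, so nothing is frozen. What remains
  is to carry the product measure over to \<open>lborel\<close> by the map that sums
  \<open>y b *\<^sub>R b\<close> over the basis.\<close>

lemma mixed_family_orthant_integral:
  fixes G :: "'d::finite set \<Rightarrow> real ^ 'd \<Rightarrow> real"
  assumes G: "mixed_family G" and bnd: "\<And>S x. \<bar>G S x\<bar> \<le> C * exp (- m * (norm x)\<^sup>2)" and m: "0 < m"
  shows "G {} z = (- 1) ^ length (coord_list :: 'd list) *
    (\<integral>y. indicator {y. \<forall>j. z $ j < y $ j} y * G UNIV y \<partial>lborel)"
proof -
  interpret product_sigma_finite "\<lambda>_ :: real ^ 'd. lborel :: real measure" by standard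
  let ?s = "(- 1) ^ length (coord_list :: 'd list) :: real"
  let ?E = "(\<lambda>j :: 'd. axis j (1 :: real)) ` UNIV"
  let ?v = "\<lambda>y. \<chi> j. y (axis j 1)"
  have G_cont: "continuous_on UNIV (G T)" for T using G unfolding mixed_family_def by blast
  have v: "(\<Sum>b\<in>Basis. y b *\<^sub>R b) = ?v y" for y :: "real ^ 'd \<Rightarrow> real"
  proof -
    have "(\<Sum>b\<in>Basis. y b *\<^sub>R b) = (\<Sum>j\<in>UNIV. y (axis j 1) *\<^sub>R axis j 1)"
      unfolding Basis_vec_real by (simp add: sum.reindex[OF inj_axis_one])
    also have "\<dots> = ?v y"
    proof -
      have "(\<Sum>j\<in>UNIV. y (axis j 1) *\<^sub>R axis j 1) $ k = (\<Sum>j\<in>UNIV. if j = k then y (axis j 1) else 0)" for k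
        unfolding sum_component by (rule sum.cong) (auto simp: axis_def)
      then show ?thesis by (simp add: vec_eq_iff)
    qed
    finally show ?thesis .
  qed
  have ind: "(\<Prod>j\<in>UNIV. indicator {z $ j<..} (y j) :: real) = of_bool (\<forall>j. z $ j < y j)" for y :: "'d \<Rightarrow> real"
  proof (cases "\<forall>j. z $ j < y j")
    case True then show ?thesis by simp
  next
    case False
    then obtain j where "\<not> z $ j < y j" by blast
    then have "(\<Prod>j\<in>UNIV. indicator {z $ j<..} (y j) :: real) = 0"
      by (intro prod_zero bexI[of _ j]) auto
    then show ?thesis using False by simp
  qed
  have "G {} z = ?s * (\<integral>y. (\<Prod>j\<in>UNIV. indicator {z $ j<..} (y (axis j 1))) * G UNIV (?v y)
      \<partial>Pi\<^sub>M ?E (\<lambda>_. lborel))"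
    using mixed_family_multiple_integral[OF G bnd m, of "[]" coord_list z] set_coord_list[where 'd='d] by simp
  also have "(\<lambda>y. (\<Prod>j\<in>UNIV. indicator {z $ j<..} (y (axis j 1))) * G UNIV (?v y)) =
      (\<lambda>y. indicator {y. \<forall>j. z $ j < y $ j} (?v y) * G UNIV (?v y))"
    unfolding ind by (auto simp: fun_eq_iff indicator_def)
  also have "(\<integral>y. indicator {y. \<forall>j. z $ j < y $ j} (?v y) * G UNIV (?v y) \<partial>Pi\<^sub>M ?E (\<lambda>_. lborel)) =
      (\<integral>y. indicator {y. \<forall>j. z $ j < y $ j} y * G UNIV y \<partial>lborel)"
  proof -
    have [measurable]: "G UNIV \<in> borel_measurable borel" by (rule borel_measurable_continuous_onI[OF G_cont])
    have [measurable]: "(\<lambda>y :: real ^ 'd. y $ j) \<in> borel_measurable borel" for j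
      by (intro borel_measurable_continuous_onI continuous_intros)
    have "(\<lambda>y :: real ^ 'd. indicator {y. \<forall>j. z $ j < y $ j} y * G UNIV y) \<in> borel_measurable borel"
      by measurable
    moreover have "(\<lambda>y. \<Sum>b\<in>Basis. y b *\<^sub>R b) \<in> measurable (Pi\<^sub>M Basis (\<lambda>_. lborel)) (borel :: (real ^ 'd) measure)"
      by measurable
    ultimately show ?thesis
      by (subst lborel_eq, subst integral_distr) (simp_all add: v flip: Basis_vec_real)
  qed
  finally show ?thesis .
qed

lemma borel_measurable_vec_nth [measurable]: "(\<lambda>y :: real ^ 'd::finite. y $ j) \<in> borel_measurable borel"
  by (intro borel_measurable_continuous_onI continuous_intros)

lemma nn_integral_lborel_vec_prod:
  fixes f :: "'d::finite \<Rightarrow> real \<Rightarrow> ennreal"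
  assumes "\<And>j. f j \<in> borel_measurable borel"
  shows "(\<integral>\<^sup>+x. (\<Prod>j\<in>UNIV. f j (x $ j)) \<partial>(lborel :: (real ^ 'd) measure)) = (\<Prod>j\<in>UNIV. \<integral>\<^sup>+t. f j t \<partial>lborel)"
proof -
  define k where "k b = (THE j. axis j 1 = (b :: real ^ 'd))" for b
  have k: "k (axis j 1) = j" for j unfolding k_def by (auto simp: axis_eq_axis)
  have r: "(\<Prod>b\<in>(Basis :: (real ^ 'd) set). h b) = (\<Prod>j\<in>UNIV. h (axis j 1))" for h :: "_ \<Rightarrow> ennreal"
    unfolding Basis_vec_real by (simp add: prod.reindex[OF inj_axis_one])
  have "(\<integral>\<^sup>+x. (\<Prod>b\<in>Basis. f (k b) (x \<bullet> b)) \<partial>(lborel :: (real ^ 'd) measure)) = (\<Prod>b\<in>(Basis :: (real ^ 'd) set). \<integral>\<^sup>+t. f (k b) t \<partial>lborel)"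
    by (rule nn_integral_lborel_prod) (use assms in auto)
  then show ?thesis unfolding r k by (simp add: inner_axis)
qed

lemma integrable_exp_neg_norm_square:
  assumes "0 < m"
  shows "integrable lborel (\<lambda>x :: real ^ 'd::finite. exp (- m * (norm x)\<^sup>2))"
proof (rule integrableI_nonneg)
  have fin: "(\<integral>\<^sup>+t. ennreal (exp (- m * t\<^sup>2)) \<partial>lborel) < \<infinity>"
    using integrable_exp_neg_square[OF assms] by (subst nn_integral_eq_integral) auto
  have "ennreal (exp (- m * (norm x)\<^sup>2)) = (\<Prod>j\<in>UNIV. ennreal (exp (- m * (x $ j)\<^sup>2)))" for x :: "real ^ 'd"
    by (simp add: norm_vec_square sum_distrib_left exp_sum prod_ennreal flip: sum_negf)
  then have "(\<integral>\<^sup>+x. ennreal (exp (- m * (norm x)\<^sup>2)) \<partial>(lborel :: (real ^ 'd) measure)) =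
      (\<Prod>j\<in>(UNIV :: 'd set). \<integral>\<^sup>+t. ennreal (exp (- m * t\<^sup>2)) \<partial>lborel)"
    by (simp only:) (rule nn_integral_lborel_vec_prod, measurable)
  also have "\<dots> < \<infinity>" using fin by (simp add: power_less_top_ennreal)
  finally show "(\<integral>\<^sup>+x. ennreal (exp (- m * (norm x)\<^sup>2)) \<partial>(lborel :: (real ^ 'd) measure)) < \<infinity>" .
qed auto

text \<open>A Koksma--Hlawka inequality in which only the full mixed partial derivative enters, because
  \<open>g\<close> vanishes at infinity.\<close>

lemma koksma_hlawka:
  fixes g :: "real ^ 'd::finite \<Rightarrow> real"
  assumes Q: "prob_space Q" "sets Q = sets borel" and g: "mixed_bound (- m) C g" and m: "0 < m"
    and D: "\<And>y. \<bar>1 / real N * (\<Sum>i=1..N. of_bool (\<forall>j. x i $ j < y $ j)) - measure Q {z. \<forall>j. z $ j < y $ j}\<bar> \<le> D"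
  shows "\<bar>1 / real N * (\<Sum>i=1..N. g (x i)) - (\<integral>z. g z \<partial>Q)\<bar>
    \<le> D * (C * (\<integral>y. exp (- m * (norm y)\<^sup>2) \<partial>(lborel :: (real ^ 'd) measure)))"
proof -
  interpret Q: prob_space Q by fact
  interpret pair_sigma_finite "lborel :: (real ^ 'd) measure" Q ..
  note [measurable_cong] = Q(2)
  from g obtain G where G: "mixed_family G" "G {} = g"
    and bnd: "\<And>S x. \<bar>G S x\<bar> \<le> C * exp (- m * (norm x)\<^sup>2)" unfolding mixed_bound_def by blast
  define s where "s = ((- 1) ^ length (coord_list :: 'd list) :: real)"
  have s: "\<bar>s\<bar> = 1" by (simp add: s_def power_abs)
  define K where "K = G UNIV"
  \<comment> \<open>\<open>I\<close> describes an orthant in either argument: the one above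
    \<open>z\<close> as a function of \<open>y\<close>, the one below \<open>y\<close> as a function
    of \<open>z\<close>. Exchanging the integrals therefore turns the representation into orthant
    probabilities.\<close>
  define I where "I z y = (indicator {y. \<forall>j. z $ j < y $ j} y :: real)" for z y :: "real ^ 'd"
  have I: "I z y = of_bool (\<forall>j. z $ j < y $ j)" for z y by (simp add: I_def indicator_def)
  have rep: "g z = s * (\<integral>y. I z y * K y \<partial>lborel)" for z
    using mixed_family_orthant_integral[OF G(1) bnd m, of z] G(2) by (simp add: s_def K_def I_def)
  have [measurable]: "K \<in> borel_measurable borel"
    using G(1) unfolding K_def mixed_family_def by (intro borel_measurable_continuous_onI) blast
  have I_meas[measurable]: "(\<lambda>(y, z). I z y) \<in> borel_measurable (borel \<Otimes>\<^sub>M borel)" unfolding I by measurable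
  have gauss: "integrable lborel (\<lambda>y :: real ^ 'd. C * exp (- m * (norm y)\<^sup>2))"
    using integrable_exp_neg_norm_square[OF m, where 'd='d] by simp
  have C: "0 \<le> C" using bnd[of "{}" 0] by simp
  have K_int: "integrable lborel K"
    by (rule Bochner_Integration.integrable_bound[OF gauss]) (use bnd[of UNIV, folded K_def] C in auto)
  have IK_int: "integrable lborel (\<lambda>y. I z y * K y)" for z
    by (rule Bochner_Integration.integrable_bound[OF K_int]) (auto simp: I)
  define H where "H y = measure Q {z. \<forall>j. z $ j < y $ j}" for y :: "real ^ 'd"
  have I_int: "(\<integral>z. I z y \<partial>Q) = H y" "integrable Q (\<lambda>z. I z y)" for y
  proof -
    have sp: "space Q = UNIV" using sets_eq_imp_space_eq[OF Q(2)] by simp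
    have e: "(\<lambda>z. I z y) = indicator {z. \<forall>j. z $ j < y $ j}" by (auto simp: I indicator_def)
    have m: "{z. \<forall>j. z $ j < y $ j} \<in> sets Q" unfolding Q(2) by measurable
    then show "(\<integral>z. I z y \<partial>Q) = H y" "integrable Q (\<lambda>z. I z y)"
      unfolding e H_def by (auto simp: sp less_top Q.emeasure_eq_measure)
  qed
  have H01: "0 \<le> H y" "H y \<le> 1" for y unfolding H_def by simp_all
  \<comment> \<open>Integrating the absolute value over \<open>z\<close> first leaves
    \<open>H y * \<bar>K y\<bar>\<close>, which the integrable \<open>K\<close> dominates.\<close>
  have pair_int: "integrable (lborel \<Otimes>\<^sub>M Q) (\<lambda>(y, z). I z y * K y)"
  proof (rule Fubini_integrable)
    have e: "(\<lambda>y. \<integral>z. norm (case (y, z) of (y, z) \<Rightarrow> I z y * K y) \<partial>Q) = (\<lambda>y. H y * \<bar>K y\<bar>)"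
      by (auto simp: abs_mult I_int(1)[symmetric] I)
    have [measurable]: "H \<in> borel_measurable borel"
      unfolding I_int(1)[symmetric] by measurable
    show "integrable lborel (\<lambda>y. \<integral>z. norm (case (y, z) of (y, z) \<Rightarrow> I z y * K y) \<partial>Q)"
      unfolding e
      by (rule Bochner_Integration.integrable_bound[OF K_int])
         (auto simp: abs_mult H01 intro!: mult_left_le_one_le)
    show "AE y in lborel. integrable Q (\<lambda>z. case (y, z) of (y, z) \<Rightarrow> I z y * K y)"
      using I_int(2) by auto
  qed measurable
  have HK_int: "integrable lborel (\<lambda>y. H y * K y)"
    using integrable_fst'[OF pair_int] by (simp add: I_int)
  have "(\<integral>z. g z \<partial>Q) = s * (\<integral>z. (\<integral>y. I z y * K y \<partial>lborel) \<partial>Q)" by (simp add: rep)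
  also have "(\<integral>z. (\<integral>y. I z y * K y \<partial>lborel) \<partial>Q) = (\<integral>y. (\<integral>z. I z y * K y \<partial>Q) \<partial>lborel)"
    using Fubini_integral[of "\<lambda>y z. I z y * K y"] pair_int by simp
  also have "\<dots> = (\<integral>y. H y * K y \<partial>lborel)" by (simp add: I_int)
  finally have mean: "(\<integral>z. g z \<partial>Q) = s * (\<integral>y. H y * K y \<partial>lborel)" .
  \<comment> \<open>\<open>L\<close> is the empirical counterpart of \<open>H\<close>. Sample mean
    and expectation are the same integral with \<open>L\<close> and \<open>H\<close> respectively,
    so the error is the integral of \<open>(L - H) * K\<close>, in which \<open>D\<close> bounds the
    first factor.\<close>
  define L where "L y = 1 / real N * (\<Sum>i=1..N. I (x i) y)" for y
  have LK: "L y * K y = 1 / real N * (\<Sum>i=1..N. I (x i) y * K y)" for y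
    by (simp add: L_def sum_distrib_right)
  have LK_int: "integrable lborel (\<lambda>y. L y * K y)" unfolding LK using IK_int by auto
  have avg: "1 / real N * (\<Sum>i=1..N. g (x i)) = s * (\<integral>y. L y * K y \<partial>lborel)"
    unfolding LK rep using IK_int by (simp add: sum_distrib_left)
  have "1 / real N * (\<Sum>i=1..N. g (x i)) - (\<integral>z. g z \<partial>Q) = s * (\<integral>y. L y * K y - H y * K y \<partial>lborel)"
    unfolding avg mean using LK_int HK_int by (simp add: right_diff_distrib)
  then have "\<bar>1 / real N * (\<Sum>i=1..N. g (x i)) - (\<integral>z. g z \<partial>Q)\<bar> = \<bar>\<integral>y. L y * K y - H y * K y \<partial>lborel\<bar>"
    using s by (simp add: abs_mult)
  also have "\<dots> \<le> (\<integral>y. \<bar>L y * K y - H y * K y\<bar> \<partial>lborel)" by (rule integral_abs_bound)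
  also have "\<dots> \<le> (\<integral>y. D * (C * exp (- m * (norm y)\<^sup>2)) \<partial>(lborel :: (real ^ 'd) measure))"
  proof (rule integral_mono)
    show "integrable lborel (\<lambda>y. \<bar>L y * K y - H y * K y\<bar>)" using LK_int HK_int by auto
    show "integrable lborel (\<lambda>y :: real ^ 'd. D * (C * exp (- m * (norm y)\<^sup>2)))" using gauss by simp
    fix y
    have LH: "\<bar>L y - H y\<bar> \<le> D" using D[of y] by (simp add: L_def H_def I)
    have "\<bar>L y * K y - H y * K y\<bar> = \<bar>L y - H y\<bar> * \<bar>K y\<bar>" by (simp only: left_diff_distrib[symmetric] abs_mult)
    also have "\<dots> \<le> D * (C * exp (- m * (norm y)\<^sup>2))"
      by (rule mult_mono) (use LH bnd in \<open>auto simp: K_def intro: order_trans[OF abs_ge_zero]\<close>)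
    finally show "\<bar>L y * K y - H y * K y\<bar> \<le> D * (C * exp (- m * (norm y)\<^sup>2))" .
  qed
  finally show ?thesis by simp
qed

section \<open>Inverse transform sampling\<close>

context
  fixes \<rho> :: "real \<Rightarrow> real"
  assumes \<rho>: "positive_continuous_density \<rho>"
begin

abbreviation law where "law \<equiv> density lborel (\<lambda>x. ennreal (\<rho> x))"

lemma positive_density_measurable [measurable]: "\<rho> \<in> borel_measurable borel"
  using \<rho> unfolding positive_continuous_density_def by (intro borel_measurable_continuous_onI) simp

lemma positive_density_pos: "0 < \<rho> x"
  using \<rho> unfolding positive_continuous_density_def by simp

lemma positive_density_nn_integral: "(\<integral>\<^sup>+x. ennreal (\<rho> x) \<partial>lborel) = 1"
proof -
  have "integrable lborel \<rho>" "integral\<^sup>L lborel \<rho> = 1"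
    using \<rho> unfolding positive_continuous_density_def by (auto simp: has_bochner_integral_iff)
  then show ?thesis using positive_density_pos by (subst nn_integral_eq_integral) (auto simp: less_imp_le)
qed

lemma real_distribution_law: "real_distribution law"
proof -
  have "prob_space law"
    by (rule prob_spaceI) (simp add: emeasure_density positive_density_nn_integral)
  then show ?thesis by (simp add: real_distribution_def real_distribution_axioms_def)
qed

text \<open>A positive density gives mass to every interval of positive length, since otherwise the
  interval would be a Lebesgue null set. The resulting injectivity makes \<open>the_inv\<close> a
  genuine inverse.\<close>

lemma cdf_law_strict_mono: "strict_mono (cdf law)"
proof (rule strict_monoI)
  fix x y :: real assume xy: "x < y"
  interpret real_distribution law by (rule real_distribution_law)
  have "emeasure law {x<..y} \<noteq> 0"
  proof
    assume "emeasure law {x<..y} = 0"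
    then have "AE t in lborel. ennreal (\<rho> t) * indicator {x<..y} t = 0"
      by (simp add: emeasure_density nn_integral_0_iff_AE)
    then have "AE t in lborel. t \<notin> {x<..y}"
    proof eventually_elim
      case (elim t)
      have "ennreal (\<rho> t) \<noteq> 0" using positive_density_pos[of t] by (simp add: ennreal_eq_0_iff not_le)
      with elim show ?case by (auto simp: indicator_def split: if_splits)
    qed
    then have "emeasure lborel {x<..y} = 0" 
    proof -
      have "{t \<in> space lborel. \<not> t \<notin> {x<..y}} = {x<..y}" by auto
      from AE_iff_measurable[OF _ this] show ?thesis using \<open>AE t in lborel. t \<notin> {x<..y}\<close> by simp
    qed
    then show False using xy by simp
  qed
  then have "0 < measure law {x<..y}" by (simp add: emeasure_eq_measure zero_less_measure_iff)
  then show "cdf law x < cdf law y" using cdf_diff_eq[OF xy] by simp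
qed

lemma cdf_law_isCont: "isCont (cdf law) x"
proof -
  interpret real_distribution law by (rule real_distribution_law)
  have "AE t in lborel. ennreal (\<rho> t) * indicator {x} t = 0"
    using AE_lborel_singleton[of x] by eventually_elim auto
  then have "emeasure law {x} = 0" by (simp add: emeasure_density nn_integral_0_iff_AE)
  then show ?thesis unfolding isCont_cdf by (simp add: measure_def)
qed

lemma cdf_law_range: "0 < cdf law x" "cdf law x < 1"
proof -
  interpret real_distribution law by (rule real_distribution_law)
  have "cdf law (x - 1) < cdf law x" "cdf law x < cdf law (x + 1)"
    using cdf_law_strict_mono by (auto simp: strict_mono_def)
  then show "0 < cdf law x" "cdf law x < 1"
    using cdf_nonneg[of "x - 1"] cdf_bounded_prob[of "x + 1"] by linarith+
qed

lemma cdf_law_surj: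
  assumes "0 < t" "t < 1"
  shows "\<exists>x. cdf law x = t"
proof -
  interpret real_distribution law by (rule real_distribution_law)
  have "eventually (\<lambda>x. cdf law x < t) at_bot" using cdf_lim_at_bot assms by (intro order_tendstoD) auto
  then obtain a where a: "cdf law a < t" by (metis eventually_at_bot_linorder order_refl)
  have "eventually (\<lambda>x. t < cdf law x) at_top" using cdf_lim_at_top_prob assms by (intro order_tendstoD) auto
  then obtain b where b: "t < cdf law b" by (metis eventually_at_top_linorder order_refl)
  have "a \<le> b" using a b cdf_nondecreasing[of b a] by linarith
  then show ?thesis using IVT[of "cdf law" a t b] a b cdf_law_isCont by auto
qed

text \<open>This carries orthant events for transported points to box events for uniform points,
  which are the events that the discrepancy counts.\<close>

lemma the_inv_cdf_less_iff:
  assumes "0 < t" "t < 1"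
  shows "the_inv (cdf law) t < y \<longleftrightarrow> t < cdf law y"
proof -
  obtain x where x: "cdf law x = t" using cdf_law_surj[OF assms] by blast
  have "inj (cdf law)" using cdf_law_strict_mono by (rule strict_mono_imp_inj_on)
  then have "the_inv (cdf law) t = x" using x the_inv_f_f by fastforce
  then have "the_inv (cdf law) t < y \<longleftrightarrow> x < y" by simp
  also have "\<dots> \<longleftrightarrow> cdf law x < cdf law y" by (simp add: strict_mono_less[OF cdf_law_strict_mono])
  finally show ?thesis unfolding x .
qed

text \<open>Off \<open>(0,1)\<close> the cumulative distribution function has no preimages, so \<^const>\<open>the_inv\<close> is
  constant there.\<close>

lemma the_inv_cdf_measurable: "the_inv (cdf law) \<in> borel_measurable borel"
  unfolding borel_measurable_iff_less
proof
  fix a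
  let ?c = "THE y :: real. False"
  have out: "the_inv (cdf law) t = ?c" if "\<not> (0 < t \<and> t < 1)" for t
  proof -
    have "cdf law x \<noteq> t" for x using cdf_law_range[of x] that by auto
    then show ?thesis by (simp add: the_inv_into_def)
  qed
  have "{t. the_inv (cdf law) t < a} =
      {0<..<1} \<inter> {..<cdf law a} \<union> (if ?c < a then - {0<..<1} else {})"
    (is "_ = ?R")
  proof (rule set_eqI)
    fix t show "t \<in> {t. the_inv (cdf law) t < a} \<longleftrightarrow> t \<in> ?R"
    proof (cases "0 < t \<and> t < 1")
      case True then show ?thesis using the_inv_cdf_less_iff[of t a] by auto
    next
      case False
      have "t \<in> {t. the_inv (cdf law) t < a} \<longleftrightarrow> ?c < a" unfolding mem_Collect_eq out[OF False] ..
      then show ?thesis using False by auto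
    qed
  qed
  also have "\<dots> \<in> sets borel" by auto
  finally show "{t \<in> space borel. the_inv (cdf law) t < a} \<in> sets borel" by simp
qed

text \<open>\<open>cdf\<close> refers to closed half-lines, whereas the orthants are defined by
  strict inequalities. The two agree because a continuous distribution function has no
  atoms.\<close>

lemma emeasure_law_lessThan: "(\<integral>\<^sup>+t. ennreal (\<rho> t) * indicator {..<y} t \<partial>lborel) = ennreal (cdf law y)"
proof -
  interpret real_distribution law by (rule real_distribution_law)
  have "(\<integral>\<^sup>+t. ennreal (\<rho> t) * indicator {..<y} t \<partial>lborel) = emeasure law {..<y}"
    by (simp add: emeasure_density)
  also have "\<dots> = ennreal (measure law {..<y})" by (simp add: emeasure_eq_measure)
  also have "measure law {..<y} = cdf law y"
  proof -
    have "(cdf law \<longlongrightarrow> cdf law y) (at_left y)"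
      using cdf_law_isCont[of y] unfolding isCont_def by (rule filterlim_mono) (auto intro: at_le)
    then show ?thesis using cdf_at_left[of y] by (intro tendsto_unique[OF trivial_limit_at_left_real])
  qed
  finally show ?thesis .
qed

end

section \<open>Orthants, the product law and the star discrepancy\<close>

lemma orthants_generate_borel:
  "(borel :: (real ^ 'd::finite) measure) = sigma UNIV (range (\<lambda>y. {x. \<forall>j. x $ j < y $ j}))"
proof -
  have "eucl_less x y \<longleftrightarrow> (\<forall>j. x $ j < y $ j)" for x y :: "real ^ 'd"
    by (simp add: eucl_less_def Basis_vec_real inner_axis)
  then show ?thesis using borel_eq_lessThan[where 'a="real ^ 'd"] by simp
qed

text \<open>Orthants form a generator of the Borel sets that is stable under intersection, by taking
  componentwise minima of the corners, and those with corners \<open>(n, ..., n)\<close> exhaust the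
  space.\<close>

lemma measure_eqI_orthants:
  fixes M N :: "(real ^ 'd::finite) measure"
  assumes M: "sets M = sets borel" and N: "sets N = sets borel" and fin: "finite_measure M"
    and eq: "\<And>y. emeasure M {x. \<forall>j. x $ j < y $ j} = emeasure N {x. \<forall>j. x $ j < y $ j}"
  shows "M = N"
proof (rule measure_eqI_generator_eq)
  let ?E = "range (\<lambda>y :: real ^ 'd. {x :: real ^ 'd. \<forall>j. x $ j < y $ j})"
  show "Int_stable ?E"
  proof (rule Int_stableI_image)
    fix a b :: "real ^ 'd"
    show "\<exists>c\<in>UNIV. {x. \<forall>j. x $ j < a $ j} \<inter> {x. \<forall>j. x $ j < b $ j} = {x :: real ^ 'd. \<forall>j. x $ j < c $ j}"
      by (rule bexI[of _ "\<chi> j. min (a $ j) (b $ j)"]) auto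
  qed
  show "sets M = sigma_sets UNIV ?E" "sets N = sigma_sets UNIV ?E"
    unfolding M N by (subst orthants_generate_borel, simp)+
  let ?A = "\<lambda>n :: nat. {x :: real ^ 'd. \<forall>j. x $ j < (\<chi> j. real n) $ j}"
  show "range ?A \<subseteq> ?E" by blast
  show "(\<Union>n. ?A n) = UNIV"
  proof -
    have "\<exists>n. \<forall>j. x $ j < real n" for x :: "real ^ 'd"
    proof -
      obtain n where "norm x < real n" using reals_Archimedean2 by blast
      then have "x $ j < real n" for j using component_le_norm_cart[of x j] by linarith
      then show ?thesis by blast
    qed
    then show ?thesis by auto
  qed
  show "emeasure M (?A n) \<noteq> \<infinity>" for n using finite_measure.emeasure_finite[OF fin] by simp
qed (use eq in auto)

lemma indicator_orthant_prod:
  fixes f :: "'d::finite \<Rightarrow> real \<Rightarrow> ennreal"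
  shows "(\<Prod>j\<in>UNIV. f j (x $ j)) * indicator {x. \<forall>j. x $ j < y $ j} x
    = (\<Prod>j\<in>UNIV. f j (x $ j) * indicator {..<y $ j} (x $ j))"
proof (cases "\<forall>j. x $ j < y $ j")
  case True then show ?thesis by (auto intro!: prod.cong)
next
  case False
  then obtain j where "\<not> x $ j < y $ j" by blast
  then have "(\<Prod>j\<in>UNIV. f j (x $ j) * indicator {..<y $ j} (x $ j)) = 0"
    by (intro prod_zero bexI[of _ j]) auto
  then show ?thesis using False by simp
qed

context
  fixes qs :: "'d::finite \<Rightarrow> real \<Rightarrow> real"
  assumes qs: "\<And>j. positive_continuous_density (qs j)"
begin

abbreviation marginal_cdf where
  "marginal_cdf j \<equiv> cdf (density lborel (\<lambda>x. ennreal (qs j x)))"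

abbreviation product_law where
  "product_law \<equiv> density lborel (\<lambda>x. ennreal (product_density qs x))"

lemma marginal_density_measurable [measurable]: "qs j \<in> borel_measurable borel"
  by (rule positive_density_measurable[OF qs])

lemma product_density_pos: "0 < product_density qs x"
  unfolding product_density_def by (intro prod_pos) (simp add: positive_density_pos[OF qs])

lemma product_density_measurable [measurable]: "product_density qs \<in> borel_measurable borel"
  unfolding product_density_def by measurable

lemma emeasure_product_law_orthant:
  "emeasure product_law {x. \<forall>j. x $ j < y $ j} = ennreal (\<Prod>j\<in>UNIV. marginal_cdf j (y $ j))"
proof -
  have "emeasure product_law {x. \<forall>j. x $ j < y $ j} =
      (\<integral>\<^sup>+x. (\<Prod>j\<in>UNIV. ennreal (qs j (x $ j))) * indicator {x. \<forall>j. x $ j < y $ j} x \<partial>lborel)"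
    by (simp add: emeasure_density) (simp add: product_density_def prod_ennreal less_imp_le positive_density_pos[OF qs])
  also have "\<dots> = (\<Prod>j\<in>UNIV. \<integral>\<^sup>+t. ennreal (qs j t) * indicator {..<y $ j} t \<partial>lborel)"
    unfolding indicator_orthant_prod[where f="\<lambda>j t. ennreal (qs j t)"]
    by (rule nn_integral_lborel_vec_prod[where f="\<lambda>j t. ennreal (qs j t) * indicator {..<y $ j} t"]) measurable
  also have "\<dots> = ennreal (\<Prod>j\<in>UNIV. marginal_cdf j (y $ j))"
    unfolding emeasure_law_lessThan[OF qs] using cdf_law_range(1)[OF qs] by (simp add: prod_ennreal less_imp_le)
  finally show ?thesis .
qed

lemma prob_space_product_law: "prob_space product_law"
proof (rule prob_spaceI)
  have "emeasure product_law (space product_law) = (\<integral>\<^sup>+x. (\<Prod>j\<in>UNIV. ennreal (qs j (x $ j))) \<partial>lborel)"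
    by (simp add: emeasure_density) (simp add: product_density_def prod_ennreal less_imp_le positive_density_pos[OF qs])
  also have "\<dots> = (\<Prod>j\<in>UNIV. \<integral>\<^sup>+t. ennreal (qs j t) \<partial>lborel)"
    by (rule nn_integral_lborel_vec_prod) measurable
  finally show "emeasure product_law (space product_law) = 1"
    by (simp add: positive_density_nn_integral[OF qs])
qed

lemma measure_product_law_orthant:
  "measure product_law {x. \<forall>j. x $ j < y $ j} = (\<Prod>j\<in>UNIV. marginal_cdf j (y $ j))"
  using emeasure_product_law_orthant[of y] cdf_law_range(1)[OF qs]
  by (simp add: measure_def prod_nonneg less_imp_le)

lemma transport_less_iff:
  assumes "u \<in> open_unit_cube"
  shows "transport qs u $ j < y \<longleftrightarrow> u $ j < marginal_cdf j y"
  using assms the_inv_cdf_less_iff[OF qs] by (simp add: transport_def open_unit_cube_def)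

lemma transport_measurable [measurable]: "transport qs \<in> borel_measurable borel"
proof (subst borel_measurable_euclidean_space, intro ballI)
  fix b :: "real ^ 'd" assume "b \<in> Basis"
  then have "b \<in> (\<lambda>j. axis j 1) ` UNIV" unfolding Basis_vec_real .
  then obtain k where k: "b = axis k 1" by blast
  show "(\<lambda>x. transport qs x \<bullet> b) \<in> borel_measurable borel"
    using the_inv_cdf_measurable[OF qs] unfolding k inner_axis transport_def by simp
qed

lemma open_unit_cube_measurable [measurable]: "(open_unit_cube :: (real ^ 'd) set) \<in> sets borel"
  unfolding open_unit_cube_def by measurable

lemma emeasure_cube_orthant:
  assumes "\<And>j. 0 \<le> z $ j" "\<And>j. z $ j \<le> 1"
  shows "emeasure lborel (open_unit_cube \<inter> {u :: real ^ 'd. \<forall>j. u $ j < z $ j}) = ennreal (\<Prod>j\<in>UNIV. z $ j)"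
proof -
  have "open_unit_cube \<inter> {u :: real ^ 'd. \<forall>j. u $ j < z $ j} = box 0 z"
    using assms unfolding open_unit_cube_def
    by (auto simp: mem_box_cart) (meson order_less_le_trans)
  then show ?thesis using assms
    by (simp add: emeasure_lborel_box_eq Basis_vec_real prod.reindex[OF inj_axis_one] inner_axis)
qed

text \<open>Both measures give the orthant below \<open>y\<close> the product of the values
  \<open>marginal_cdf j (y $ j)\<close>: on the left this is the volume of a box in the
  cube.\<close>

lemma distr_uniform_transport:
  "distr (uniform_measure lborel open_unit_cube) borel (transport qs) = product_law"
proof (rule measure_eqI_orthants)
  have cube: "emeasure lborel (open_unit_cube :: (real ^ 'd) set) = 1"
  proof -
    have "(open_unit_cube :: (real ^ 'd) set) = open_unit_cube \<inter> {u. \<forall>j. u $ j < (\<chi> j. 1) $ j}"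
      unfolding open_unit_cube_def by auto
    then show ?thesis using emeasure_cube_orthant[of "\<chi> j. 1"] by simp
  qed
  have "prob_space (uniform_measure lborel (open_unit_cube :: (real ^ 'd) set))"
    by (rule prob_space_uniform_measure) (simp_all add: cube)
  then have "prob_space (distr (uniform_measure lborel open_unit_cube) borel (transport qs))"
    by (rule prob_space.prob_space_distr) simp
  then show "finite_measure (distr (uniform_measure lborel open_unit_cube) borel (transport qs))"
    by (rule prob_space.finite_measure)
  fix y :: "real ^ 'd"
  let ?z = "\<chi> j. marginal_cdf j (y $ j)"
  have z: "0 < ?z $ j" "?z $ j < 1" for j using cdf_law_range[OF qs] by auto
  have "open_unit_cube \<inter> transport qs -` {x. \<forall>j. x $ j < y $ j} = open_unit_cube \<inter> {u. \<forall>j. u $ j < ?z $ j}"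
    using transport_less_iff by auto
  then have "emeasure (distr (uniform_measure lborel open_unit_cube) borel (transport qs)) {x. \<forall>j. x $ j < y $ j}
     = emeasure lborel (open_unit_cube \<inter> {u. \<forall>j. u $ j < ?z $ j})"
    by (subst emeasure_distr) (simp_all add: cube divide_ennreal_def)
  also have "\<dots> = ennreal (\<Prod>j\<in>UNIV. ?z $ j)" by (rule emeasure_cube_orthant) (use z in \<open>auto intro: less_imp_le\<close>)
  finally show "emeasure (distr (uniform_measure lborel open_unit_cube) borel (transport qs)) {x. \<forall>j. x $ j < y $ j}
     = emeasure product_law {x. \<forall>j. x $ j < y $ j}"
    unfolding emeasure_product_law_orthant by simp
qed simp_all

text \<open>The orthant below \<open>y\<close> corresponds to the anchored box whose corner consists
  of the values of the marginal distribution functions at \<open>y\<close>. These lie strictly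
  between 0 and 1, so the corner is admissible in the supremum.\<close>

lemma star_discrepancy_bounds_orthants:
  assumes u: "\<And>i. i \<in> {1..N} \<Longrightarrow> u i \<in> open_unit_cube"
  shows "\<bar>1 / real N * (\<Sum>i=1..N. of_bool (\<forall>j. transport qs (u i) $ j < y $ j))
    - measure product_law {x. \<forall>j. x $ j < y $ j}\<bar> \<le> star_discrepancy N u"
proof -
  define h where "h z = \<bar>1 / real N * (\<Sum>i=1..N. indicator {x. \<forall>j. 0 \<le> x $ j \<and> x $ j < z $ j} (u i))
         - (\<Prod>j\<in>UNIV. z $ j)\<bar>" for z :: "real ^ 'd"
  let ?z = "\<chi> j. marginal_cdf j (y $ j)"
  have z: "?z \<in> open_unit_cube" using cdf_law_range[OF qs] by (simp add: open_unit_cube_def)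
  \<comment> \<open>The supremum is one of real numbers, so it bounds its members only once the set
    is known to be bounded above.\<close>
  have "h z \<le> 1" if "z \<in> open_unit_cube" for z
  proof -
    have "0 \<le> (\<Prod>j\<in>UNIV. z $ j)" "(\<Prod>j\<in>UNIV. z $ j) \<le> 1"
      using that unfolding open_unit_cube_def by (simp_all add: prod_nonneg prod_le_1 less_imp_le)
    moreover have "0 \<le> 1 / real N * (\<Sum>i=1..N. indicator {x. \<forall>j. 0 \<le> x $ j \<and> x $ j < z $ j} (u i))"
      by (simp add: sum_nonneg)
    moreover have "1 / real N * (\<Sum>i=1..N. indicator {x. \<forall>j. 0 \<le> x $ j \<and> x $ j < z $ j} (u i)) \<le> 1"
    proof -
      have "(\<Sum>i=1..N. indicator {x. \<forall>j. 0 \<le> x $ j \<and> x $ j < z $ j} (u i)) \<le> (\<Sum>i=1..N. 1 :: real)"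
        by (rule sum_mono) (auto simp: indicator_def)
      then show ?thesis by (auto simp: divide_simps)
    qed
    ultimately show ?thesis unfolding h_def by linarith
  qed
  then have "bdd_above (h ` open_unit_cube)" by (intro bdd_aboveI[of _ 1]) auto
  then have "h ?z \<le> star_discrepancy N u"
    unfolding star_discrepancy_def h_def[symmetric] using z by (rule cSUP_upper2[OF _ _ order_refl])
  moreover have "of_bool (\<forall>j. transport qs (u i) $ j < y $ j) =
      (indicator {x. \<forall>j. 0 \<le> x $ j \<and> x $ j < ?z $ j} (u i) :: real)" if "i \<in> {1..N}" for i
    using u[OF that] transport_less_iff[OF u[OF that]]
    by (auto simp: indicator_def open_unit_cube_def less_imp_le)
  ultimately show ?thesis unfolding h_def measure_product_law_orthant by simp
qed

lemma rqmc_integration_error: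
  fixes g :: "real ^ 'd \<Rightarrow> real"
  assumes "\<And>i. i \<in> {1..N} \<Longrightarrow> u i \<in> open_unit_cube" "mixed_bound (- m) C g" "0 < m"
  shows "\<bar>1 / real N * (\<Sum>i=1..N. g (transport qs (u i))) - (\<integral>x. g x \<partial>product_law)\<bar>
    \<le> star_discrepancy N u * (C * (\<integral>y. exp (- m * (norm y)\<^sup>2) \<partial>(lborel :: (real ^ 'd) measure)))"
  by (rule koksma_hlawka[OF prob_space_product_law _ assms(2,3) star_discrepancy_bounds_orthants])
     (use assms(1) in auto)

end

section \<open>Error rates\<close>

text \<open>The space is cut into shells on which the squared norm lies between \<open>n\<close> and
  \<open>n + 1\<close>. The integrand is at most \<open>exp (\<beta> * (n + 1))\<close> there and
  the tail bound gives mass at most \<open>K * exp (- \<gamma> * n)\<close>, so a geometric series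
  of ratio \<open>exp (\<beta> - \<gamma>)\<close> dominates. The origin, which lies in no shell,
  accounts for the summand 1.\<close>

lemma integrable_exp_square_of_tail:
  fixes Q :: "(real ^ 'd::finite) measure"
  assumes Q: "prob_space Q" "sets Q = sets borel" and \<beta>: "0 < \<beta>" "\<beta> < \<gamma>"
    and K: "0 \<le> K" "\<And>t. 0 \<le> t \<Longrightarrow> measure Q {x. norm x > t} \<le> K * exp (- \<gamma> * t\<^sup>2)"
  shows "integrable Q (\<lambda>x. exp (\<beta> * (norm x)\<^sup>2))"
proof (rule integrableI_nonneg)
  interpret prob_space Q by fact
  note [measurable_cong] = Q(2)
  let ?A = "\<lambda>n. {x :: real ^ 'd. norm x > sqrt (real n)}"
  let ?a = "\<lambda>n. exp (\<beta> * (real n + 1)) * (K * exp (- \<gamma> * real n))"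
  have "ennreal (exp (\<beta> * (norm x)\<^sup>2)) \<le> 1 + (\<Sum>n. ennreal (exp (\<beta> * (real n + 1))) * indicator (?A n) x)" for x
  proof (cases "x = 0")
    case True
    then show ?thesis by simp
  next
    case False
    \<comment> \<open>The ceiling minus one, unlike the floor, makes \<open>n\<close> strictly
      smaller than the squared norm, as membership in \<open>?A n\<close> demands.\<close>
    define n where "n = nat (\<lceil>(norm x)\<^sup>2\<rceil> - 1)"
    have pos: "0 < (norm x)\<^sup>2" using False by simp
    then have "real n = real_of_int \<lceil>(norm x)\<^sup>2\<rceil> - 1" unfolding n_def by simp
    then have n: "real n < (norm x)\<^sup>2" "(norm x)\<^sup>2 \<le> real n + 1" by linarith+
    then have "sqrt (real n) < norm x" using real_sqrt_less_mono[OF n(1)] by simp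
    then have "ennreal (exp (\<beta> * (norm x)\<^sup>2)) \<le> ennreal (exp (\<beta> * (real n + 1))) * indicator (?A n) x"
      using n \<beta> by (simp add: ennreal_leI)
    also have "\<dots> \<le> (\<Sum>n. ennreal (exp (\<beta> * (real n + 1))) * indicator (?A n) x)"
      using ennreal_suminf_lessD[of "\<lambda>n. ennreal (exp (\<beta> * (real n + 1))) * indicator (?A n) x" _ n]
      by (meson leI less_irrefl)
    finally show ?thesis by (rule order_trans) simp
  qed
  then have "(\<integral>\<^sup>+x. ennreal (exp (\<beta> * (norm x)\<^sup>2)) \<partial>Q) \<le>
      (\<integral>\<^sup>+x. 1 + (\<Sum>n. ennreal (exp (\<beta> * (real n + 1))) * indicator (?A n) x) \<partial>Q)"
    by (intro nn_integral_mono)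
  also have "\<dots> = 1 + (\<Sum>n. ennreal (exp (\<beta> * (real n + 1))) * emeasure Q (?A n))"
    by (subst nn_integral_add) (simp_all add: nn_integral_suminf nn_integral_cmult emeasure_space_1)
  also have "\<dots> \<le> 1 + (\<Sum>n. ennreal (?a n))"
  proof (intro add_left_mono suminf_le summableI)
    fix n
    have "emeasure Q (?A n) \<le> ennreal (K * exp (- \<gamma> * real n))"
      using K(2)[of "sqrt (real n)"] by (simp add: emeasure_eq_measure ennreal_leI)
    then have "ennreal (exp (\<beta> * (real n + 1))) * emeasure Q (?A n) \<le>
        ennreal (exp (\<beta> * (real n + 1))) * ennreal (K * exp (- \<gamma> * real n))"
      by (rule mult_left_mono) simp
    then show "ennreal (exp (\<beta> * (real n + 1))) * emeasure Q (?A n) \<le> ennreal (?a n)"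
      using K(1) by (simp add: ennreal_mult)
  qed
  also have "\<dots> < \<infinity>"
  proof -
    have "?a n = K * exp \<beta> * exp (\<beta> - \<gamma>) ^ n" for n
      unfolding exp_of_nat_mult[symmetric] by (simp add: algebra_simps flip: exp_add)
    moreover have "summable (\<lambda>n. K * exp \<beta> * exp (\<beta> - \<gamma>) ^ n)"
      using \<beta> by (intro summable_mult summable_geometric) simp
    ultimately have "(\<Sum>n. ennreal (?a n)) \<noteq> top"
      using K(1) by (intro ennreal_suminf_neq_top) (simp_all only: , simp)
    then show ?thesis by (simp add: less_top)
  qed
  finally show "(\<integral>\<^sup>+x. ennreal (exp (\<beta> * (norm x)\<^sup>2)) \<partial>Q) < \<infinity>" .
qed (use Q in auto)

text \<open>Lowering the rate from \<open>\<alpha>\<close> to \<open>\<gamma>\<close> absorbs the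
  factor \<open>t powi \<eta>\<close> for large \<open>t\<close>, and enlarging the constant covers
  the remaining bounded range.\<close>

lemma sub_gaussian_tail_bound:
  fixes q :: "real ^ 'd::finite \<Rightarrow> real"
  assumes Q: "prob_space (density lborel (\<lambda>x. ennreal (q x)))" and tail: "sub_gaussian_tail q \<eta> \<alpha>"
    and \<gamma>: "0 < \<gamma>" "\<gamma> < \<alpha>"
  obtains K where "0 \<le> K"
    "\<And>t. 0 \<le> t \<Longrightarrow> measure (density lborel (\<lambda>x. ennreal (q x))) {x. norm x > t} \<le> K * exp (- \<gamma> * t\<^sup>2)"
proof -
  define p where "p t = measure (density lborel (\<lambda>x. ennreal (q x))) {x. norm x > t}" for t
  have p: "0 \<le> p t" "p t \<le> 1" for t unfolding p_def using prob_space.prob_le_1[OF Q] by auto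
  from tail have "Limsup at_top (\<lambda>t. ereal (t powi (- \<eta>) * exp (\<alpha> * t\<^sup>2) * p t)) \<noteq> \<infinity>"
    unfolding sub_gaussian_tail_def p_def by simp
  then obtain n where "Limsup at_top (\<lambda>t. ereal (t powi (- \<eta>) * exp (\<alpha> * t\<^sup>2) * p t)) < ereal (real n)"
    unfolding less_PInf_Ex_of_nat by blast
  from Limsup_lessD[OF this]
  have ev1: "\<forall>\<^sub>F t in at_top. t powi (- \<eta>) * exp (\<alpha> * t\<^sup>2) * p t < real n" by simp
  \<comment> \<open>For \<open>t \<ge> 1\<close> the exponent \<open>2 * k\<close> dominates
    \<open>\<eta>\<close> of either sign, and a power of \<open>t\<^sup>2\<close> compares directly
    with the exponential.\<close>
  define k where "k = nat \<bar>\<eta>\<bar>"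
  have "((\<lambda>t. (t\<^sup>2) ^ k / exp ((\<alpha> - \<gamma>) * t\<^sup>2)) \<longlongrightarrow> 0) at_top"
  proof -
    have lim: "filterlim (\<lambda>t :: real. (\<alpha> - \<gamma>) * t\<^sup>2) at_top at_top"
      by (intro filterlim_tendsto_pos_mult_at_top[OF tendsto_const] filterlim_pow_at_top filterlim_ident)
         (use \<gamma> in auto)
    have "((\<lambda>t. (1 / (\<alpha> - \<gamma>)) ^ k * (((\<alpha> - \<gamma>) * t\<^sup>2) ^ k / exp ((\<alpha> - \<gamma>) * t\<^sup>2))) \<longlongrightarrow> (1 / (\<alpha> - \<gamma>)) ^ k * 0) at_top"
      by (intro tendsto_mult tendsto_const filterlim_compose[OF tendsto_power_div_exp_0 lim])
    moreover have "(1 / (\<alpha> - \<gamma>)) ^ k * (((\<alpha> - \<gamma>) * t\<^sup>2) ^ k / exp ((\<alpha> - \<gamma>) * t\<^sup>2)) =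
        (t\<^sup>2) ^ k / exp ((\<alpha> - \<gamma>) * t\<^sup>2)" for t
      using \<gamma> by (simp add: power_mult_distrib power_divide)
    ultimately show ?thesis by simp
  qed
  then have "\<forall>\<^sub>F t in at_top. (t\<^sup>2) ^ k / exp ((\<alpha> - \<gamma>) * t\<^sup>2) < 1" by (rule order_tendstoD) simp
  with ev1 eventually_ge_at_top[of 1]
  have "\<forall>\<^sub>F t in at_top. p t \<le> real n * exp (- \<gamma> * t\<^sup>2)"
  proof eventually_elim
    case (elim t)
    have pos: "0 < t powi \<eta>" using elim by simp
    have "t powi \<eta> \<le> (t\<^sup>2) ^ k"
    proof -
      have "t powi \<eta> \<le> t powi (int (2 * k))"
        by (rule power_int_increasing) (use elim in \<open>auto simp: k_def\<close>)
      then show ?thesis by (simp only: power_int_of_nat power_mult)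
    qed
    also have "\<dots> \<le> exp ((\<alpha> - \<gamma>) * t\<^sup>2)" using elim by (simp add: divide_simps)
    finally have le: "t powi \<eta> \<le> exp ((\<alpha> - \<gamma>) * t\<^sup>2)" .
    have "exp (\<alpha> * t\<^sup>2) * p t \<le> real n * t powi \<eta>"
      using elim(1) pos by (simp add: power_int_minus field_simps)
    also have "\<dots> \<le> real n * exp ((\<alpha> - \<gamma>) * t\<^sup>2)" by (intro mult_left_mono le) simp
    finally have "p t \<le> real n * exp ((\<alpha> - \<gamma>) * t\<^sup>2) / exp (\<alpha> * t\<^sup>2)" by (simp add: field_simps)
    also have "\<dots> = real n * exp (- \<gamma> * t\<^sup>2)" by (simp add: left_diff_distrib exp_diff exp_minus field_simps)
    finally show ?case .
  qed
  then obtain T where T: "\<And>t. t \<ge> T \<Longrightarrow> p t \<le> real n * exp (- \<gamma> * t\<^sup>2)"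
    unfolding eventually_at_top_linorder by blast
  \<comment> \<open>Below \<open>T\<close> only \<open>p t \<le> 1\<close> is known; there
    \<open>exp (\<gamma> * T\<^sup>2)\<close> outweighs the decaying factor.\<close>
  let ?K = "max (real n) (exp (\<gamma> * T\<^sup>2))"
  have "p t \<le> ?K * exp (- \<gamma> * t\<^sup>2)" if "0 \<le> t" for t
  proof (cases "t \<ge> T")
    case True
    show ?thesis by (rule order_trans[OF T[OF True]]) (intro mult_right_mono, auto)
  next
    case False
    then have "t\<^sup>2 \<le> T\<^sup>2" using that by (intro power_mono) auto
    then have "1 \<le> exp (\<gamma> * T\<^sup>2) * exp (- \<gamma> * t\<^sup>2)" using \<gamma> by (simp flip: exp_add)
    also have "\<dots> \<le> ?K * exp (- \<gamma> * t\<^sup>2)" by (intro mult_right_mono) auto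
    finally show ?thesis using p(2)[of t] by linarith
  qed
  then show ?thesis using that[of ?K] unfolding p_def by auto
qed

lemma integrable_exp_square_sub_gaussian:
  fixes q :: "real ^ 'd::finite \<Rightarrow> real"
  assumes "prob_space (density lborel (\<lambda>x. ennreal (q x)))" "sub_gaussian_tail q \<eta> \<alpha>" "0 < \<beta>" "\<beta> < \<alpha>"
  shows "integrable (density lborel (\<lambda>x. ennreal (q x))) (\<lambda>x. exp (\<beta> * (norm x)\<^sup>2))"
proof -
  \<comment> \<open>The midpoint leaves room on both sides: below \<open>\<alpha>\<close> for the
    tail bound, above \<open>\<beta>\<close> for the convergence of the series.\<close>
  obtain K where K: "0 \<le> K" "\<And>t. 0 \<le> t \<Longrightarrow>
      measure (density lborel (\<lambda>x. ennreal (q x))) {x. norm x > t} \<le> K * exp (- ((\<beta> + \<alpha>) / 2) * t\<^sup>2)"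
    using sub_gaussian_tail_bound[OF assms(1,2), of "(\<beta> + \<alpha>) / 2"] assms(3,4) by auto
  show ?thesis
    by (rule integrable_exp_square_of_tail[OF assms(1) _ assms(3) _ K]) (use assms in auto)
qed

text \<open>Jensen's inequality with equal weights. Convexity of the power is taken on the positive
  reals, which is why strictly positive weight functions appear below.\<close>

lemma powr_mean_le_mean_powr:
  assumes "1 \<le> p" "1 \<le> N" "\<And>i. i \<in> {1..N} \<Longrightarrow> 0 < y i"
  shows "(1 / real N * (\<Sum>i=1..N. y i)) powr p \<le> 1 / real N * (\<Sum>i=1..N. y i powr p)"
  using convex_on_sum[of "{1..N}" "{0<..}" "\<lambda>x. x powr p" "\<lambda>_. 1 / real N" y] powr_convex[OF assms(1)] assms(2,3)
  by (simp add: sum_distrib_left)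

lemma rqmcD:
  fixes u :: "nat \<Rightarrow> nat \<Rightarrow> 'w \<Rightarrow> real ^ 'd::finite"
  assumes "rqmc_points A P u" "N \<in> A"
  shows "2 \<le> N" "prob_space (P N)" "\<And>i. i \<in> {1..N} \<Longrightarrow> u N i \<in> borel_measurable (P N)"
    "\<And>i s. i \<in> {1..N} \<Longrightarrow> s \<in> space (P N) \<Longrightarrow> u N i s \<in> open_unit_cube"
    "\<And>i. i \<in> {1..N} \<Longrightarrow> distr (P N) borel (u N i) = uniform_measure lborel open_unit_cube"
  using assms unfolding rqmc_points_def by blast+

lemma ln_power_over_powr_tendsto_0:
  assumes "0 < e"
  shows "(\<lambda>N. ln (real N) ^ k / real N powr e) \<longlonglongrightarrow> 0"
proof -
  have "filterlim (\<lambda>N. e * ln (real N)) at_top sequentially"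
    by (intro filterlim_tendsto_pos_mult_at_top[OF tendsto_const assms]
        filterlim_compose[OF ln_at_top filterlim_real_sequentially])
  then have "(\<lambda>N. (1 / e) ^ k * ((e * ln (real N)) ^ k / exp (e * ln (real N)))) \<longlonglongrightarrow> (1 / e) ^ k * 0"
    by (intro tendsto_mult tendsto_const filterlim_compose[OF tendsto_power_div_exp_0])
  then have "(\<lambda>N. (1 / e) ^ k * ((e * ln (real N)) ^ k / exp (e * ln (real N)))) \<longlonglongrightarrow> 0" by simp
  moreover have "\<forall>\<^sub>F N in sequentially. (1 / e) ^ k * ((e * ln (real N)) ^ k / exp (e * ln (real N)))
      = ln (real N) ^ k / real N powr e"
    using eventually_gt_at_top[of 0]
    by eventually_elim (use assms in \<open>simp add: powr_def power_mult_distrib power_divide\<close>)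
  ultimately show ?thesis by (rule Lim_transform_eventually)
qed

lemma mixed_bound_nonneg: "mixed_bound M C g \<Longrightarrow> 0 \<le> C"
  using mixed_bound_abs_le[of M C g 0] by simp

section \<open>Sample means over the RQMC points\<close>

context
  fixes qs :: "'d::finite \<Rightarrow> real \<Rightarrow> real" and A :: "nat set" and P :: "nat \<Rightarrow> 'w measure"
    and u :: "nat \<Rightarrow> nat \<Rightarrow> 'w \<Rightarrow> real ^ 'd"
  assumes qs: "\<And>j. positive_continuous_density (qs j)" and rqmc: "rqmc_points A P u"
begin

lemma transport_point_measurable:
  assumes "N \<in> A" "i \<in> {1..N}"
  shows "(\<lambda>s. transport qs (u N i s)) \<in> borel_measurable (P N)"
  by (rule measurable_compose[OF rqmcD(3)[OF rqmc assms] transport_measurable[OF qs]])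

lemma distr_transport_point:
  assumes "N \<in> A" "i \<in> {1..N}"
  shows "distr (P N) borel (\<lambda>s. transport qs (u N i s)) = product_law qs"
proof -
  have "distr (P N) borel (\<lambda>s. transport qs (u N i s)) = distr (distr (P N) borel (u N i)) borel (transport qs)"
    using rqmcD(3)[OF rqmc assms] transport_measurable[OF qs] by (subst distr_distr) (auto simp: comp_def)
  then show ?thesis using rqmcD(5)[OF rqmc assms] distr_uniform_transport[OF qs] by simp
qed

text \<open>Jensen's inequality moves the power inside the sample mean. Every transported point has
  law \<open>product_law qs\<close>, so the expectation of the mean of \<open>V powr p\<close> is
  the same constant \<open>K\<close> for every \<open>N\<close>, and only the factor
  \<open>r N\<close> is left.\<close>

lemma Lp_rate_of_mean_bound:
  fixes V :: "real ^ 'd \<Rightarrow> real"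
  assumes p: "1 \<le> p" and V: "V \<in> borel_measurable borel" "\<And>x. 0 < V x"
      "integrable (product_law qs) (\<lambda>x. V x powr p)"
    and X: "\<And>N. N \<in> A \<Longrightarrow> X N \<in> borel_measurable (P N)"
    and r: "\<And>N. 0 \<le> r N"
    and bnd: "\<forall>\<^sub>F N in sequentially. N \<in> A \<longrightarrow>
      (AE s in P N. \<bar>X N s\<bar> \<le> r N * (1 / real N * (\<Sum>i=1..N. V (transport qs (u N i s)))))"
  shows "Lp_rate p A P X r"
proof -
  define K where "K = (\<integral>x. V x powr p \<partial>product_law qs)"
  have K: "0 \<le> K" unfolding K_def by simp
  have main: "integrable (P N) (\<lambda>s. \<bar>X N s\<bar> powr p) \<and>
      (LINT s|P N. \<bar>X N s\<bar> powr p) powr (1 / p) \<le> K powr (1 / p) * r N"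
    if N: "N \<in> A" and b: "AE s in P N. \<bar>X N s\<bar> \<le> r N * (1 / real N * (\<Sum>i=1..N. V (transport qs (u N i s))))" for N
  proof -
    define T where "T i s = transport qs (u N i s)" for i s
    have N1: "1 \<le> N" using rqmcD(1)[OF rqmc N] by simp
    define Y where "Y s = r N powr p * (1 / real N * (\<Sum>i=1..N. V (T i s) powr p))" for s
    have VT: "integrable (P N) (\<lambda>s. V (T i s) powr p)" "(LINT s|P N. V (T i s) powr p) = K" if i: "i \<in> {1..N}" for i
    proof -
      note d = distr_transport_point[OF N i] and m = transport_point_measurable[OF N i]
      have b: "(\<lambda>x. V x powr p) \<in> borel_measurable borel" using V(1) by simp
      show "integrable (P N) (\<lambda>s. V (T i s) powr p)" "(LINT s|P N. V (T i s) powr p) = K"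
        using V(3) unfolding K_def d[symmetric] T_def
        by (simp_all add: integrable_distr_eq[OF m b] integral_distr[OF m b])
    qed
    have Y: "integrable (P N) Y" "(LINT s|P N. Y s) = r N powr p * K"
    proof -
      show "integrable (P N) Y"
        unfolding Y_def by (intro integrable_mult_right Bochner_Integration.integrable_sum VT)
      have "(LINT s|P N. (\<Sum>i=1..N. V (T i s) powr p)) = real N * K"
        using VT by (subst Bochner_Integration.integral_sum) auto
      then show "(LINT s|P N. Y s) = r N powr p * K" using N1 unfolding Y_def by simp
    qed
    have le: "AE s in P N. \<bar>X N s\<bar> powr p \<le> Y s"
      using b
    proof eventually_elim
      case (elim s)
      have avg: "0 \<le> 1 / real N * (\<Sum>i=1..N. V (T i s))"
        using V(2) by (intro mult_nonneg_nonneg sum_nonneg) (auto intro: less_imp_le)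
      have "\<bar>X N s\<bar> powr p \<le> (r N * (1 / real N * (\<Sum>i=1..N. V (T i s)))) powr p"
        using elim p unfolding T_def by (intro powr_mono2) auto
      also have "\<dots> = r N powr p * (1 / real N * (\<Sum>i=1..N. V (T i s))) powr p"
        by (rule powr_mult)
      also have "\<dots> \<le> Y s"
        unfolding Y_def by (intro mult_left_mono powr_mean_le_mean_powr p N1 V(2)) auto
      finally show ?case .
    qed
    have int: "integrable (P N) (\<lambda>s. \<bar>X N s\<bar> powr p)"
    proof (rule Bochner_Integration.integrable_bound[OF Y(1)])
      show "(\<lambda>s. \<bar>X N s\<bar> powr p) \<in> borel_measurable (P N)" using X[OF N] by simp
      show "AE s in P N. norm (\<bar>X N s\<bar> powr p) \<le> norm (Y s)" using le by eventually_elim simp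
    qed
    have "(LINT s|P N. \<bar>X N s\<bar> powr p) \<le> r N powr p * K"
      using integral_mono_AE[OF int Y(1) le] Y(2) by simp
    then have "(LINT s|P N. \<bar>X N s\<bar> powr p) powr (1 / p) \<le> (r N powr p * K) powr (1 / p)"
      using p by (intro powr_mono2) auto
    also have "\<dots> = K powr (1 / p) * r N" using p r[of N] K by (simp add: powr_mult powr_powr)
    finally show ?thesis using int by blast
  qed
  have ev: "\<forall>\<^sub>F N in inf sequentially (principal A). integrable (P N) (\<lambda>s. \<bar>X N s\<bar> powr p) \<and>
      (LINT s|P N. \<bar>X N s\<bar> powr p) powr (1 / p) \<le> K powr (1 / p) * r N"
    unfolding eventually_inf_principal using bnd by eventually_elim (use main in blast)
  show ?thesis
    unfolding Lp_rate_def
  proof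
    show "\<forall>\<^sub>F N in inf sequentially (principal A). integrable (P N) (\<lambda>s. \<bar>X N s\<bar> powr p)"
      using ev by eventually_elim simp
    show "(\<lambda>N. (LINT s|P N. \<bar>X N s\<bar> powr p) powr (1 / p)) \<in> O[inf sequentially (principal A)](r)"
      by (rule bigoI[of _ "K powr (1 / p)"]) (use ev in eventually_elim, use r in simp)
  qed
qed

abbreviation sample_mean where
  "sample_mean g N s \<equiv> 1 / real N * (\<Sum>i=1..N. g (transport qs (u N i s)))"

lemma sample_mean_measurable:
  assumes "N \<in> A" "g \<in> borel_measurable borel"
  shows "(\<lambda>s. sample_mean g N s) \<in> borel_measurable (P N)"
  by (intro borel_measurable_times borel_measurable_const borel_measurable_sum
      measurable_compose[OF transport_point_measurable[OF assms(1)] assms(2)])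

text \<open>For decaying \<open>g\<close>, the Koksma-Hlawka bound combined with the almost sure
  discrepancy bound gives a deterministic rate. It serves (i) directly and the lower bound on the
  denominator in both parts.\<close>

lemma integration_error_rate:
  assumes g: "mixed_bound (- m) C g" and m: "0 < m"
  obtains K where "0 \<le> K" "\<And>N. N \<in> A \<Longrightarrow> AE s in P N.
    \<bar>sample_mean g N s - (\<integral>x. g x \<partial>product_law qs)\<bar> \<le> K * (ln (real N) ^ (CARD('d) - 1) / real N)"
proof -
  from rqmc obtain B where B: "B > 0"
    "\<And>N. N \<in> A \<Longrightarrow> AE s in P N. star_discrepancy N (\<lambda>i. u N i s) \<le> B * (ln (real N) ^ (CARD('d) - 1) / real N)"
    unfolding rqmc_points_def by blast
  define J where "J = C * (\<integral>y. exp (- m * (norm y)\<^sup>2) \<partial>(lborel :: (real ^ 'd) measure))"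
  have J: "0 \<le> J" unfolding J_def using mixed_bound_nonneg[OF g] by simp
  have "AE s in P N. \<bar>sample_mean g N s - (\<integral>x. g x \<partial>product_law qs)\<bar> \<le> B * J * (ln (real N) ^ (CARD('d) - 1) / real N)"
    if N: "N \<in> A" for N
    using B(2)[OF N] AE_space
  proof eventually_elim
    case (elim s)
    have "\<bar>sample_mean g N s - (\<integral>x. g x \<partial>product_law qs)\<bar> \<le> star_discrepancy N (\<lambda>i. u N i s) * J"
      unfolding J_def
      by (rule rqmc_integration_error[OF qs _ g m]) (use rqmcD(4)[OF rqmc N] elim in auto)
    also have "\<dots> \<le> B * (ln (real N) ^ (CARD('d) - 1) / real N) * J"
      by (rule mult_right_mono[OF elim(1) J])
    finally show ?case by (simp add: mult_ac)
  qed
  then show ?thesis using B(1) J by (intro that[of "B * J"]) auto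
qed

text \<open>A cutoff makes any \<open>\<omega>\<close> decay and, by nonnegativity, can only
  decrease the sample mean. By dominated convergence some cutoff of \<open>\<omega>\<close> has a
  positive mean; half of that mean survives the integration error for large
  \<open>N\<close>.\<close>

lemma sample_mean_lower_bound:
  assumes \<omega>: "mixed_bound M C \<omega>" and nonneg: "\<And>x. 0 \<le> \<omega> x"
    and int: "integrable (product_law qs) \<omega>" and pos: "0 < (\<integral>x. \<omega> x \<partial>product_law qs)"
  obtains c where "0 < c" "\<forall>\<^sub>F N in sequentially. N \<in> A \<longrightarrow> (AE s in P N. c \<le> sample_mean \<omega> N s)"
proof -
  obtain \<kappa> :: "real \<Rightarrow> real ^ 'd \<Rightarrow> real" where
    \<kappa>01: "\<And>\<rho> x. 0 \<le> \<kappa> \<rho> x \<and> \<kappa> \<rho> x \<le> 1" and \<kappa>1: "\<And>\<rho> x. (norm x)\<^sup>2 \<le> \<rho> \<Longrightarrow> \<kappa> \<rho> x = 1" and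
    \<kappa>b: "\<And>m \<delta>. 0 \<le> m \<Longrightarrow> 0 < \<delta> \<Longrightarrow> \<exists>B>0. \<forall>\<rho>. mixed_bound (- m) (B * exp ((m + \<delta>) * \<rho>)) (\<kappa> \<rho>)"
    using radial_cutoff_exists[where 'd='d] by blast
  \<comment> \<open>With decay \<open>\<bar>M\<bar> + 1\<close> in the cutoff, the product with
    \<open>\<omega>\<close> has rate at most \<open>- 1\<close>, whatever the sign of
    \<open>M\<close>.\<close>
  obtain B where B: "0 < B" "\<And>\<rho>. mixed_bound (- (\<bar>M\<bar> + 1)) (B * exp ((\<bar>M\<bar> + 1 + 1) * \<rho>)) (\<kappa> \<rho>)"
    using \<kappa>b[of "\<bar>M\<bar> + 1" 1] by auto
  have prod: "mixed_bound (- 1) (2 ^ CARD('d) * C * (B * exp ((\<bar>M\<bar> + 1 + 1) * \<rho>))) (\<lambda>x. \<omega> x * \<kappa> \<rho> x)" for \<rho>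
    by (rule mixed_bound_mono[OF mixed_bound_mult[OF \<omega> B(2)]])
       (use B(1) mixed_bound_nonneg[OF \<omega>] in auto)
  have meas: "\<omega> \<in> borel_measurable borel" "\<kappa> \<rho> \<in> borel_measurable borel" for \<rho>
    using mixed_bound_continuous \<omega> B(2) by (auto intro!: borel_measurable_continuous_onI)
  have "(\<lambda>n. \<integral>x. \<omega> x * \<kappa> (real n) x \<partial>product_law qs) \<longlonglongrightarrow> (\<integral>x. \<omega> x \<partial>product_law qs)"
  proof (rule integral_dominated_convergence[OF _ _ int])
    show "AE x in product_law qs. (\<lambda>n. \<omega> x * \<kappa> (real n) x) \<longlonglongrightarrow> \<omega> x"
    proof (rule AE_I2)
      fix x :: "real ^ 'd"
      obtain n0 where n0: "(norm x)\<^sup>2 \<le> real n0" using real_arch_simple by blast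
      have "\<forall>\<^sub>F n in sequentially. \<omega> x * \<kappa> (real n) x = \<omega> x"
        using eventually_ge_at_top[of n0] by eventually_elim (use n0 \<kappa>1 in simp)
      then show "(\<lambda>n. \<omega> x * \<kappa> (real n) x) \<longlonglongrightarrow> \<omega> x" by (rule tendsto_eventually)
    qed
    show "AE x in product_law qs. norm (\<omega> x * \<kappa> (real n) x) \<le> \<omega> x" for n
      using nonneg \<kappa>01 by (auto simp: abs_mult intro!: mult_left_le)
  qed (use meas in auto)
  then have "\<forall>\<^sub>F n in sequentially. 0 < (\<integral>x. \<omega> x * \<kappa> (real n) x \<partial>product_law qs)"
    using pos by (rule order_tendstoD)
  then obtain n where n: "0 < (\<integral>x. \<omega> x * \<kappa> (real n) x \<partial>product_law qs)"
    unfolding eventually_sequentially by blast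
  define c where "c = (\<integral>x. \<omega> x * \<kappa> (real n) x \<partial>product_law qs)"
  obtain K where K: "0 \<le> K" "\<And>N. N \<in> A \<Longrightarrow> AE s in P N.
    \<bar>sample_mean (\<lambda>x. \<omega> x * \<kappa> (real n) x) N s - c\<bar> \<le> K * (ln (real N) ^ (CARD('d) - 1) / real N)"
    using integration_error_rate[OF prod, of "real n"] unfolding c_def by auto
  have "(\<lambda>N. K * (ln (real N) ^ (CARD('d) - 1) / real N powr 1)) \<longlonglongrightarrow> K * 0"
    by (intro tendsto_mult tendsto_const ln_power_over_powr_tendsto_0) simp
  then have "(\<lambda>N. K * (ln (real N) ^ (CARD('d) - 1) / real N)) \<longlonglongrightarrow> 0" by simp
  then have "\<forall>\<^sub>F N in sequentially. K * (ln (real N) ^ (CARD('d) - 1) / real N) < c / 2"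
    using n by (intro order_tendstoD) (auto simp: c_def)
  then have "\<forall>\<^sub>F N in sequentially. N \<in> A \<longrightarrow> (AE s in P N. c / 2 \<le> sample_mean \<omega> N s)"
  proof eventually_elim
    case (elim N)
    show ?case
    proof
      assume "N \<in> A"
      from K(2)[OF this] show "AE s in P N. c / 2 \<le> sample_mean \<omega> N s"
      proof eventually_elim
        case (elim s)
        have "sample_mean (\<lambda>x. \<omega> x * \<kappa> (real n) x) N s \<le> sample_mean \<omega> N s"
          by (intro mult_left_mono sum_mono mult_left_le) (use nonneg \<kappa>01 in auto)
        then show ?case using elim \<open>K * _ < c / 2\<close> by linarith
      qed
    qed
  qed
  then show ?thesis using n by (intro that[of "c / 2"]) (auto simp: c_def)
qed

text \<open>A cutoff of decay \<open>M + 2 * \<delta>\<close> turns the rate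
  \<open>M + \<delta>\<close> of \<open>g\<close> into \<open>- \<delta>\<close>, at the price
  \<open>exp ((M + 3 * \<delta>) * \<rho>)\<close> in the discrepancy bound. The discarded part is
  at most a multiple of \<open>exp ((M + 3 * \<delta> - a) * \<rho>)\<close> times the weight
  \<open>exp ((a - \<delta>) * (norm x)\<^sup>2)\<close>. Once \<open>exp (a * \<rho>)\<close>
  equals \<open>N\<close>, both are of order \<open>N powr (- 1 + (M + 3 * \<delta>) / a)\<close>,
  up to a power of the logarithm.\<close>

lemma truncated_integration_error:
  assumes g: "mixed_bound (M + \<delta>) C g" and M: "0 \<le> M" and \<delta>: "0 < \<delta>" and a: "M + 3 * \<delta> \<le> a"
    and W: "integrable (product_law qs) (\<lambda>x. exp ((a - \<delta>) * (norm x)\<^sup>2))"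
    and e: "(M + 3 * \<delta>) / a < e"
  obtains K where "0 \<le> K" "\<forall>\<^sub>F N in sequentially. N \<in> A \<longrightarrow> (AE s in P N.
    \<bar>sample_mean g N s - (\<integral>x. g x \<partial>product_law qs)\<bar> \<le>
      K * real N powr (- 1 + e) * sample_mean (\<lambda>x. exp ((a - \<delta>) * (norm x)\<^sup>2)) N s)"
proof -
  interpret Q: prob_space "product_law qs" by (rule prob_space_product_law[OF qs])
  let ?W = "\<lambda>x :: real ^ 'd. exp ((a - \<delta>) * (norm x)\<^sup>2)"
  have a0: "0 < a" using M \<delta> a by linarith
  have C: "0 \<le> C" by (rule mixed_bound_nonneg[OF g])
  obtain \<kappa> :: "real \<Rightarrow> real ^ 'd \<Rightarrow> real" where
    \<kappa>01: "\<And>\<rho> x. 0 \<le> \<kappa> \<rho> x \<and> \<kappa> \<rho> x \<le> 1" and \<kappa>1: "\<And>\<rho> x. (norm x)\<^sup>2 \<le> \<rho> \<Longrightarrow> \<kappa> \<rho> x = 1" and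
    \<kappa>b: "\<And>m \<delta>. 0 \<le> m \<Longrightarrow> 0 < \<delta> \<Longrightarrow> \<exists>B>0. \<forall>\<rho>. mixed_bound (- m) (B * exp ((m + \<delta>) * \<rho>)) (\<kappa> \<rho>)"
    using radial_cutoff_exists[where 'd='d] by blast
  obtain B where B: "0 < B" "\<And>\<rho>. mixed_bound (- (M + 2 * \<delta>)) (B * exp ((M + 2 * \<delta> + \<delta>) * \<rho>)) (\<kappa> \<rho>)"
    using \<kappa>b[of "M + 2 * \<delta>" \<delta>] M \<delta> by auto
  have M3: "M + 2 * \<delta> + \<delta> = M + 3 * \<delta>" by simp
  define B' where "B' = 2 ^ CARD('d) * C * B"
  have B': "0 \<le> B'" using C B(1) by (simp add: B'_def)
  have prod: "mixed_bound (- \<delta>) (B' * exp ((M + 3 * \<delta>) * \<rho>)) (\<lambda>x. g x * \<kappa> \<rho> x)" for \<rho>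
  proof (rule mixed_bound_mono)
    show "mixed_bound (M + \<delta> + - (M + 2 * \<delta>)) (2 ^ CARD('d) * C * (B * exp ((M + 3 * \<delta>) * \<rho>))) (\<lambda>x. g x * \<kappa> \<rho> x)"
      by (rule mixed_bound_mult[OF g B(2)[unfolded M3]]) (use B(1) C in auto)
  qed (use B' in \<open>auto simp: B'_def\<close>)
  have meas: "g \<in> borel_measurable borel" "\<kappa> \<rho> \<in> borel_measurable borel" for \<rho>
    using mixed_bound_continuous g B(2) by (auto intro!: borel_measurable_continuous_onI)
  from rqmc obtain D where D: "D > 0"
    "\<And>N. N \<in> A \<Longrightarrow> AE s in P N. star_discrepancy N (\<lambda>i. u N i s) \<le> D * (ln (real N) ^ (CARD('d) - 1) / real N)"
    unfolding rqmc_points_def by blast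
  define J where "J = (\<integral>y. exp (- \<delta> * (norm y)\<^sup>2) \<partial>(lborel :: (real ^ 'd) measure))"
  have J: "0 \<le> J" by (simp add: J_def)
  define I where "I = (\<integral>x. ?W x \<partial>product_law qs)"
  have I: "0 \<le> I" by (simp add: I_def)
  have ad: "0 \<le> a - \<delta>" using M \<delta> a by linarith
  have W1: "1 \<le> ?W x" for x using ad by simp
  \<comment> \<open>Outside the ball the exponent \<open>M + \<delta>\<close> is written as
    \<open>M + 2 * \<delta> - a\<close> plus the exponent \<open>a - \<delta>\<close> of the weight.
    The first summand is negative, hence its exponential is largest at the boundary.\<close>
  have tail: "\<bar>g x * (1 - \<kappa> \<rho> x)\<bar> \<le> C * exp ((M + 3 * \<delta> - a) * \<rho>) * ?W x" if \<rho>: "0 \<le> \<rho>" for x \<rho>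
  proof (cases "(norm x)\<^sup>2 \<le> \<rho>")
    case True
    then show ?thesis using \<kappa>1 C by simp
  next
    case False
    have "\<bar>g x * (1 - \<kappa> \<rho> x)\<bar> \<le> \<bar>g x\<bar> * 1"
      unfolding abs_mult using \<kappa>01[of \<rho> x] by (intro mult_left_mono) auto
    also have "\<dots> \<le> C * exp ((M + \<delta>) * (norm x)\<^sup>2)" using mixed_bound_abs_le[OF g] by simp
    also have "exp ((M + \<delta>) * (norm x)\<^sup>2) = exp ((M + 2 * \<delta> - a) * (norm x)\<^sup>2) * ?W x"
      unfolding exp_add[symmetric] distrib_right[symmetric] by simp
    also have "C * (exp ((M + 2 * \<delta> - a) * (norm x)\<^sup>2) * ?W x) \<le> C * (exp ((M + 3 * \<delta> - a) * \<rho>) * ?W x)"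
    proof (intro mult_left_mono mult_right_mono C)
      have "(M + 2 * \<delta> - a) * (norm x)\<^sup>2 \<le> (M + 2 * \<delta> - a) * \<rho>"
        using False a \<delta> by (intro mult_left_mono_neg) auto
      also have "\<dots> \<le> (M + 3 * \<delta> - a) * \<rho>" using \<delta> \<rho> by (intro mult_right_mono) auto
      finally show "exp ((M + 2 * \<delta> - a) * (norm x)\<^sup>2) \<le> exp ((M + 3 * \<delta> - a) * \<rho>)" by simp
    qed simp
    finally show ?thesis by (simp add: mult_ac)
  qed
  have int_tail: "integrable (product_law qs) (\<lambda>x. g x * (1 - \<kappa> \<rho> x))" if "0 \<le> \<rho>" for \<rho>
  proof (rule Bochner_Integration.integrable_bound)
    show "integrable (product_law qs) (\<lambda>x. C * exp ((M + 3 * \<delta> - a) * \<rho>) * ?W x)" using W by simp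
    show "AE x in product_law qs. norm (g x * (1 - \<kappa> \<rho> x)) \<le> norm (C * exp ((M + 3 * \<delta> - a) * \<rho>) * ?W x)"
      using tail[OF that] C by (auto simp: abs_mult)
  qed (use meas in simp)
  have int_body: "integrable (product_law qs) (\<lambda>x. g x * \<kappa> \<rho> x)" for \<rho>
  proof (rule Q.integrable_const_bound)
    show "AE x in product_law qs. norm (g x * \<kappa> \<rho> x) \<le> B' * exp ((M + 3 * \<delta>) * \<rho>)"
    proof (rule AE_I2)
      fix x
      have "\<bar>g x * \<kappa> \<rho> x\<bar> \<le> B' * exp ((M + 3 * \<delta>) * \<rho>) * exp (- \<delta> * (norm x)\<^sup>2)"
        by (rule mixed_bound_abs_le[OF prod])
      also have "\<dots> \<le> B' * exp ((M + 3 * \<delta>) * \<rho>) * 1"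
        using B' \<delta> by (intro mult_left_mono) auto
      finally show "norm (g x * \<kappa> \<rho> x) \<le> B' * exp ((M + 3 * \<delta>) * \<rho>)" by simp
    qed
  qed (use meas in simp)
  \<comment> \<open>The summands come from the discrepancy error of the truncated function, the
    sample mean of the discarded part and, with the factor \<open>I\<close>, its
    expectation.\<close>
  define K where "K = D * B' * J + C * (1 + I)"
  have K: "0 \<le> K" unfolding K_def using D(1) B' J C I by simp
  \<comment> \<open>This is the slack in the exponent that absorbs the power of the
    logarithm.\<close>
  define e' where "e' = e - (M + 3 * \<delta>) / a"
  have e': "0 < e'" using e by (simp add: e'_def)
  have "(\<lambda>N. ln (real N) ^ (CARD('d) - 1) / real N powr e') \<longlonglongrightarrow> 0"
    by (rule ln_power_over_powr_tendsto_0[OF e'])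
  then have "\<forall>\<^sub>F N in sequentially. ln (real N) ^ (CARD('d) - 1) / real N powr e' < 1"
    by (rule order_tendstoD) simp
  then have "\<forall>\<^sub>F N in sequentially. N \<in> A \<longrightarrow> (AE s in P N.
      \<bar>sample_mean g N s - (\<integral>x. g x \<partial>product_law qs)\<bar> \<le> K * real N powr (- 1 + e) * sample_mean ?W N s)"
    using eventually_ge_at_top[of 1]
  proof eventually_elim
    case (elim N)
    \<comment> \<open>This choice makes \<open>exp (- a * \<rho>)\<close> equal to
      \<open>1 / N\<close>, which balances the two errors.\<close>
    define \<rho> where "\<rho> = ln (real N) / a"
    have \<rho>: "0 \<le> \<rho>" using elim(2) a0 by (simp add: \<rho>_def)
    have N0: "0 < real N" using elim(2) by simp
    define R where "R = real N powr (- 1 + e)"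
    have R0: "0 \<le> R" by (simp add: R_def)
    have E1: "exp ((M + 3 * \<delta>) * \<rho>) = real N powr ((M + 3 * \<delta>) / a)"
      using N0 by (simp add: powr_def \<rho>_def)
    have E2: "exp ((M + 3 * \<delta> - a) * \<rho>) \<le> R"
    proof -
      have "exp ((M + 3 * \<delta> - a) * \<rho>) = real N powr ((M + 3 * \<delta>) / a - 1)"
        using N0 a0 by (simp add: powr_def \<rho>_def field_simps)
      also have "\<dots> \<le> R" unfolding R_def using elim(2) e by (intro powr_mono) auto
      finally show ?thesis .
    qed
    have E3: "ln (real N) ^ (CARD('d) - 1) / real N * exp ((M + 3 * \<delta>) * \<rho>) \<le> R"
    proof -
      have "ln (real N) ^ (CARD('d) - 1) \<le> real N powr e'" using elim(1) N0 by (simp add: divide_simps)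
      then have "ln (real N) ^ (CARD('d) - 1) / real N * exp ((M + 3 * \<delta>) * \<rho>) \<le>
          real N powr e' / real N * real N powr ((M + 3 * \<delta>) / a)"
        unfolding E1 using N0 by (intro mult_right_mono divide_right_mono) auto
      also have "\<dots> = R"
      proof -
        have "real N powr e' / real N = real N powr (e' - 1)" using N0 by (simp add: powr_diff)
        then show ?thesis unfolding R_def e'_def by (simp add: powr_add[symmetric])
      qed
      finally show ?thesis .
    qed
    show ?case
      unfolding R_def[symmetric]
    proof
      assume NA: "N \<in> A"
      show "AE s in P N. \<bar>sample_mean g N s - (\<integral>x. g x \<partial>product_law qs)\<bar> \<le> K * R * sample_mean ?W N s"
        using D(2)[OF NA] AE_space
      proof eventually_elim
        case (elim s)
        let ?body = "\<lambda>x. g x * \<kappa> \<rho> x" and ?tail = "\<lambda>x. g x * (1 - \<kappa> \<rho> x)"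
        have split: "g = (\<lambda>x. ?body x + ?tail x)" by (simp add: fun_eq_iff algebra_simps)
        \<comment> \<open>Since the weight is at least 1, deterministic errors may be multiplied by
          its sample mean, which gives all three errors a common form.\<close>
        have W_mean: "1 \<le> sample_mean ?W N s"
        proof -
          have "(\<Sum>i=1..N. 1 :: real) \<le> (\<Sum>i=1..N. ?W (transport qs (u N i s)))" by (intro sum_mono W1)
          then show ?thesis using N0 by (simp add: divide_simps)
        qed
        have "\<bar>sample_mean ?body N s - (\<integral>x. ?body x \<partial>product_law qs)\<bar> \<le>
            star_discrepancy N (\<lambda>i. u N i s) * (B' * exp ((M + 3 * \<delta>) * \<rho>) * J)"
          unfolding J_def by (rule rqmc_integration_error[OF qs _ prod \<delta>])
            (use rqmcD(4)[OF rqmc NA] elim in auto)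
        also have "\<dots> \<le> D * (ln (real N) ^ (CARD('d) - 1) / real N) * (B' * exp ((M + 3 * \<delta>) * \<rho>) * J)"
          by (rule mult_right_mono[OF elim(1)]) (use B' J in simp)
        also have "\<dots> = (D * B' * J) * (ln (real N) ^ (CARD('d) - 1) / real N * exp ((M + 3 * \<delta>) * \<rho>))" by simp
        also have "\<dots> \<le> (D * B' * J) * R" by (rule mult_left_mono[OF E3]) (use D(1) B' J in simp)
        also have "\<dots> \<le> (D * B' * J) * R * sample_mean ?W N s"
          using mult_left_mono[OF W_mean, of "(D * B' * J) * R"] D(1) B' J R0 by simp
        finally have body: "\<bar>sample_mean ?body N s - (\<integral>x. ?body x \<partial>product_law qs)\<bar>
            \<le> (D * B' * J) * R * sample_mean ?W N s" .
        have t: "\<bar>?tail x\<bar> \<le> C * R * ?W x" for x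
          by (rule order_trans[OF tail[OF \<rho>]]) (intro mult_right_mono mult_left_mono E2 C, auto)
        have "\<bar>sample_mean ?tail N s\<bar> \<le> 1 / real N * (\<Sum>i=1..N. C * R * ?W (transport qs (u N i s)))"
          unfolding abs_mult by (intro mult_mono order_trans[OF sum_abs] sum_mono t) (auto simp: sum_nonneg)
        also have "\<dots> = C * R * sample_mean ?W N s" by (simp add: sum_distrib_left)
        finally have tail1: "\<bar>sample_mean ?tail N s\<bar> \<le> C * R * sample_mean ?W N s" .
        have "\<bar>\<integral>x. ?tail x \<partial>product_law qs\<bar> \<le> (\<integral>x. \<bar>?tail x\<bar> \<partial>product_law qs)" by (rule integral_abs_bound)
        also have "\<dots> \<le> (\<integral>x. C * R * ?W x \<partial>product_law qs)"
          by (rule integral_mono) (use int_tail[OF \<rho>] W t in auto)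
        also have "\<dots> = C * R * I" by (simp add: I_def)
        also have "\<dots> \<le> C * R * I * sample_mean ?W N s"
          using mult_left_mono[OF W_mean, of "C * R * I"] C I R0 by simp
        finally have tail2: "\<bar>\<integral>x. ?tail x \<partial>product_law qs\<bar> \<le> C * R * I * sample_mean ?W N s" .
        have s1: "sample_mean g N s = sample_mean ?body N s + sample_mean ?tail N s"
          by (subst split) (simp add: sum.distrib add_divide_distrib)
        have s2: "(\<integral>x. g x \<partial>product_law qs) = (\<integral>x. ?body x \<partial>product_law qs) + (\<integral>x. ?tail x \<partial>product_law qs)"
          by (subst split) (rule Bochner_Integration.integral_add[OF int_body int_tail[OF \<rho>]])
        have "K * R * sample_mean ?W N s = (D * B' * J) * R * sample_mean ?W N s +
            C * R * sample_mean ?W N s + C * R * I * sample_mean ?W N s"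
          unfolding K_def by (simp only: distrib_left distrib_right mult_1_right mult_ac)
        then show ?case unfolding s1 s2 using body tail1 tail2 by linarith
      qed
    qed
  qed
  then show ?thesis using K by (rule that[rotated])
qed

end

section \<open>The self-normalized estimator\<close>

text \<open>The difference of the ratios equals \<open>((a - I) - I / J * (b - J)) / b\<close>,
  which is linear in the two errors apart from the division by \<open>b\<close>.\<close>

lemma self_normalized_error_le:
  fixes a b I J c :: real
  assumes "0 < c" "c \<le> b" "0 < J"
  shows "\<bar>(if b = 0 then 0 else a / b) - I / J\<bar> \<le> (\<bar>a - I\<bar> + \<bar>I / J\<bar> * \<bar>b - J\<bar>) / c"
proof -
  have b: "0 < b" using assms by linarith
  have "a / b - I / J = ((a - I) - I / J * (b - J)) / b" using b assms(3) by (simp add: field_simps)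
  then have "\<bar>a / b - I / J\<bar> = \<bar>(a - I) - I / J * (b - J)\<bar> / b" using b by simp
  also have "\<dots> \<le> (\<bar>a - I\<bar> + \<bar>I / J * (b - J)\<bar>) / b" using b
    by (intro divide_right_mono abs_triangle_ineq4) auto
  also have "\<dots> \<le> (\<bar>a - I\<bar> + \<bar>I / J * (b - J)\<bar>) / c" using assms b by (intro divide_left_mono) auto
  finally show ?thesis using b by (simp add: abs_mult)
qed

text \<open>Numerator and denominator share the rate \<open>r\<close> and the weight
  \<open>W\<close>, so the error of the ratio is again at most \<open>r N\<close> times a sample
  mean, with the lower bound on the denominator entering the constant.\<close>

lemma snis_Lp_rate:
  fixes qs :: "'d::finite \<Rightarrow> real \<Rightarrow> real" and A :: "nat set" and P :: "nat \<Rightarrow> 'w measure"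
    and u :: "nat \<Rightarrow> nat \<Rightarrow> 'w \<Rightarrow> real ^ 'd" and \<omega> f W :: "real ^ 'd \<Rightarrow> real"
  assumes qs: "\<And>j. positive_continuous_density (qs j)" and rqmc: "rqmc_points A P u"
    and \<omega>: "mixed_bound M C \<omega>" "\<And>x. 0 \<le> \<omega> x" "integrable (product_law qs) \<omega>"
      "0 < (\<integral>x. \<omega> x \<partial>product_law qs)"
    and f: "continuous_on UNIV f"
    and p: "1 \<le> p"
    and W: "W \<in> borel_measurable borel" "\<And>x. 0 < W x" "integrable (product_law qs) (\<lambda>x. W x powr p)"
    and r: "\<And>N. 0 \<le> r N" and K: "0 \<le> K1" "0 \<le> K2"
    and num: "\<forall>\<^sub>F N in sequentially. N \<in> A \<longrightarrow> (AE s in P N.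
      \<bar>sample_mean qs u (\<lambda>x. \<omega> x * f x) N s - (\<integral>x. \<omega> x * f x \<partial>product_law qs)\<bar> \<le> K1 * r N * sample_mean qs u W N s)"
    and den: "\<forall>\<^sub>F N in sequentially. N \<in> A \<longrightarrow> (AE s in P N.
      \<bar>sample_mean qs u \<omega> N s - (\<integral>x. \<omega> x \<partial>product_law qs)\<bar> \<le> K2 * r N * sample_mean qs u W N s)"
  shows "Lp_rate p A P (\<lambda>N s. snis_estimator \<omega> f N (\<lambda>i. transport qs (u N i s)) -
    (\<integral>x. \<omega> x * f x \<partial>product_law qs) / (\<integral>x. \<omega> x \<partial>product_law qs)) r"
proof -
  define I where "I = (\<integral>x. \<omega> x * f x \<partial>product_law qs)"
  define J where "J = (\<integral>x. \<omega> x \<partial>product_law qs)"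
  obtain c where c: "0 < c" and low: "\<forall>\<^sub>F N in sequentially. N \<in> A \<longrightarrow> (AE s in P N. c \<le> sample_mean qs u \<omega> N s)"
    using sample_mean_lower_bound[OF qs rqmc \<omega>] by blast
  define t where "t = \<bar>I / J\<bar>"
  have t: "0 \<le> t" by (simp add: t_def)
  \<comment> \<open>The added 1 keeps the weight \<open>k * W x\<close> strictly positive even if
    \<open>K1\<close> and \<open>K2\<close> vanish.\<close>
  define k where "k = (K1 + t * K2) / c + 1"
  have k: "0 < k" unfolding k_def using K c t by (simp add: add_nonneg_pos)
  have \<omega>_meas: "\<omega> \<in> borel_measurable borel" and f_meas: "f \<in> borel_measurable borel"
    using mixed_bound_continuous[OF \<omega>(1)] f by (auto intro!: borel_measurable_continuous_onI)
  show ?thesis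
    unfolding I_def[symmetric] J_def[symmetric]
  proof (rule Lp_rate_of_mean_bound[OF qs rqmc p, of "\<lambda>x. k * W x"])
    show "(\<lambda>x. k * W x) \<in> borel_measurable borel" "\<And>x. 0 < k * W x" using W k by auto
    show "integrable (product_law qs) (\<lambda>x. (k * W x) powr p)"
      using W(3) by (simp add: powr_mult)
    show "(\<lambda>s. snis_estimator \<omega> f N (\<lambda>i. transport qs (u N i s)) - I / J) \<in> borel_measurable (P N)" if "N \<in> A" for N
    proof -
      have [measurable]: "(\<lambda>s. sample_mean qs u \<omega> N s) \<in> borel_measurable (P N)"
        "(\<lambda>s. sample_mean qs u (\<lambda>x. \<omega> x * f x) N s) \<in> borel_measurable (P N)"
        using \<omega>_meas f_meas by (intro sample_mean_measurable[OF qs rqmc that]; simp)+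
      show ?thesis unfolding snis_estimator_def by measurable
    qed
    show "\<forall>\<^sub>F N in sequentially. N \<in> A \<longrightarrow> (AE s in P N. \<bar>snis_estimator \<omega> f N (\<lambda>i. transport qs (u N i s)) - I / J\<bar>
        \<le> r N * (1 / real N * (\<Sum>i=1..N. k * W (transport qs (u N i s)))))"
      using low num den
    proof eventually_elim
      case (elim N)
      show ?case
      proof
        assume "N \<in> A"
        with elim have "AE s in P N. c \<le> sample_mean qs u \<omega> N s"
          "AE s in P N. \<bar>sample_mean qs u (\<lambda>x. \<omega> x * f x) N s - I\<bar> \<le> K1 * r N * sample_mean qs u W N s"
          "AE s in P N. \<bar>sample_mean qs u \<omega> N s - J\<bar> \<le> K2 * r N * sample_mean qs u W N s"
          unfolding I_def J_def by blast+
        then show "AE s in P N. \<bar>snis_estimator \<omega> f N (\<lambda>i. transport qs (u N i s)) - I / J\<bar>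
            \<le> r N * (1 / real N * (\<Sum>i=1..N. k * W (transport qs (u N i s))))"
        proof eventually_elim
          case (elim s)
          let ?w = "sample_mean qs u W N s"
          have w: "0 \<le> ?w" using W(2) by (intro mult_nonneg_nonneg sum_nonneg) (auto intro: less_imp_le)
          have "\<bar>snis_estimator \<omega> f N (\<lambda>i. transport qs (u N i s)) - I / J\<bar> \<le>
              (\<bar>sample_mean qs u (\<lambda>x. \<omega> x * f x) N s - I\<bar> + \<bar>I / J\<bar> * \<bar>sample_mean qs u \<omega> N s - J\<bar>) / c"
            unfolding snis_estimator_def
            by (rule self_normalized_error_le[OF c elim(1)]) (use \<omega>(4) in \<open>simp add: J_def\<close>)
          also have "\<dots> \<le> (K1 * r N * ?w + \<bar>I / J\<bar> * (K2 * r N * ?w)) / c"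
            by (intro divide_right_mono add_mono mult_left_mono elim) (use c in auto)
          also have "\<dots> = (k - 1) * (r N * ?w)" 
          proof -
            have "(K1 * r N * w + t * (K2 * r N * w)) / c = (k - 1) * (r N * w)" for w
              unfolding k_def using c by (simp add: field_simps)
            then show ?thesis unfolding t_def .
          qed
          also have "\<dots> \<le> k * (r N * ?w)" 
            by (intro mult_right_mono mult_nonneg_nonneg r w) simp
          also have "\<dots> = r N * (1 / real N * (\<Sum>i=1..N. k * W (transport qs (u N i s))))"
            by (simp add: sum_distrib_left mult_ac)
          finally show ?case .
        qed
      qed
    qed
  qed (rule r)
qed

lemma density_expectation:
  fixes qs :: "'d::finite \<Rightarrow> real \<Rightarrow> real"
  assumes qs: "\<And>j. positive_continuous_density (qs j)"
    and g: "g \<in> borel_measurable borel"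
  shows "(\<integral>x. g x \<partial>product_law qs) = (\<integral>x. product_density qs x * g x \<partial>lborel)"
    "integrable (product_law qs) g \<longleftrightarrow> integrable lborel (\<lambda>x. product_density qs x * g x)"
  using product_density_pos[of qs, OF qs] product_density_measurable[of qs, OF qs] g
  by (simp_all add: integral_real_density integrable_real_density less_imp_le)

theorem theorem2:
  fixes qs :: "'d::finite \<Rightarrow> real \<Rightarrow> real"
    and q \<pi>' \<omega> f :: "real ^ 'd \<Rightarrow> real"
    and M\<^sub>\<omega> M\<^sub>f :: real
    and A :: "nat set"
    and P :: "nat \<Rightarrow> 'w measure"
    and u :: "nat \<Rightarrow> nat \<Rightarrow> 'w \<Rightarrow> real ^ 'd"
    and err :: "nat \<Rightarrow> 'w \<Rightarrow> real"
  assumes "\<And>j. positive_continuous_density (qs j)"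
    and "q = product_density qs"
    and "\<And>x. 0 \<le> \<pi>' x"
    and "integrable lborel \<pi>'"
    and "0 < (LINT x|lborel. \<pi>' x)"
    and "\<omega> = (\<lambda>x. \<pi>' x / q x)"
    and "rqmc_points A P u"
    and "growth_condition M\<^sub>\<omega> \<omega>"
    and "growth_condition M\<^sub>f f"
    and "err = (\<lambda>N s. snis_estimator \<omega> f N (\<lambda>i. transport qs (u N i s)) - target_expectation \<pi>' f)"
  shows
    "(max M\<^sub>\<omega> (M\<^sub>\<omega> + M\<^sub>f) < 0 \<longrightarrow>
       (\<forall>p\<ge>1. Lp_rate p A P err (\<lambda>N. 1 / real N * ln (real N) ^ (CARD('d) - 1))))
     \<and>
     (\<forall>v p \<alpha> :: real. \<forall>\<eta> :: int.
        v > 1 \<and> integrable lborel (\<lambda>x. \<bar>f x\<bar> powr v * q x) \<and> 1 \<le> p \<and> p < v \<and>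
        (\<forall>M>0. growth_condition M \<omega>) \<and>
        \<alpha> > 0 \<and> sub_gaussian_tail q \<eta> \<alpha> \<and> 0 \<le> M\<^sub>f \<and> M\<^sub>f < \<alpha> / p \<longrightarrow>
        (\<forall>\<epsilon>>0. Lp_rate p A P err (\<lambda>N. real N powr (- 1 + p * M\<^sub>f / \<alpha> + \<epsilon>))))"
proof -
  note qs = assms(1) and rqmc = assms(7)
  interpret Q: prob_space "product_law qs" by (rule prob_space_product_law[OF qs])
  obtain C\<^sub>\<omega> where \<omega>b: "mixed_bound M\<^sub>\<omega> C\<^sub>\<omega> \<omega>" using growth_condition_imp_mixed_bound[OF assms(8)] by blast
  obtain C\<^sub>f where fb: "mixed_bound M\<^sub>f C\<^sub>f f" using growth_condition_imp_mixed_bound[OF assms(9)] by blast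
  have \<omega>0: "0 \<le> \<omega> x" for x
    using assms(3) product_density_pos[of qs, OF qs] by (simp add: assms(2,6) less_imp_le)
  have q\<omega>: "product_density qs x * \<omega> x = \<pi>' x" for x
    using product_density_pos[of qs x, OF qs] by (simp add: assms(2,6))
  have f_cont: "continuous_on UNIV f" using mixed_bound_continuous[OF fb] .
  have meas: "\<omega> \<in> borel_measurable borel" "f \<in> borel_measurable borel"
    using mixed_bound_continuous[OF \<omega>b] f_cont by (auto intro!: borel_measurable_continuous_onI)
  have \<omega>_int: "integrable (product_law qs) \<omega>" "(\<integral>x. \<omega> x \<partial>product_law qs) = (\<integral>x. \<pi>' x \<partial>lborel)"
    using density_expectation[OF qs meas(1)] assms(4) by (simp_all add: q\<omega>)
  then have \<omega>_pos: "0 < (\<integral>x. \<omega> x \<partial>product_law qs)" using assms(5) by simp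
  \<comment> \<open>The target expectation becomes a ratio of two means under the product law, the
    quantities that the sample means approximate.\<close>
  have "(\<integral>x. \<omega> x * f x \<partial>product_law qs) = (\<integral>x. product_density qs x * (\<omega> x * f x) \<partial>lborel)"
    by (rule density_expectation(1)[OF qs]) (use meas in simp)
  also have "\<dots> = (\<integral>x. f x * \<pi>' x \<partial>lborel)"
  proof -
    have "product_density qs x * (\<omega> x * f x) = f x * \<pi>' x" for x
      unfolding mult.assoc[symmetric] q\<omega> by simp
    then show ?thesis by (simp only:)
  qed
  finally have err: "err = (\<lambda>N s. snis_estimator \<omega> f N (\<lambda>i. transport qs (u N i s)) -
      (\<integral>x. \<omega> x * f x \<partial>product_law qs) / (\<integral>x. \<omega> x \<partial>product_law qs))"
    using assms(10) \<omega>_int(2) by (simp add: target_expectation_def)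
  show ?thesis
  proof (intro conjI impI allI)
    fix p :: real
    assume neg: "max M\<^sub>\<omega> (M\<^sub>\<omega> + M\<^sub>f) < 0" and p: "1 \<le> p"
    have m1: "0 < - M\<^sub>\<omega>" and m2: "0 < - (M\<^sub>\<omega> + M\<^sub>f)" using neg by auto
    have b1: "mixed_bound (- (- M\<^sub>\<omega>)) C\<^sub>\<omega> \<omega>" using \<omega>b by simp
    have b2: "mixed_bound (- (- (M\<^sub>\<omega> + M\<^sub>f))) (2 ^ CARD('d) * C\<^sub>\<omega> * C\<^sub>f) (\<lambda>x. \<omega> x * f x)"
      using mixed_bound_mult[OF \<omega>b fb mixed_bound_nonneg[OF \<omega>b] mixed_bound_nonneg[OF fb]]
      by (simp only: minus_minus)
    obtain K2 where K2: "0 \<le> K2" "\<And>N. N \<in> A \<Longrightarrow> AE s in P N.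
        \<bar>sample_mean qs u \<omega> N s - (\<integral>x. \<omega> x \<partial>product_law qs)\<bar> \<le> K2 * (ln (real N) ^ (CARD('d) - 1) / real N)"
      using integration_error_rate[of qs, OF qs rqmc b1 m1] by blast
    obtain K1 where K1: "0 \<le> K1" "\<And>N. N \<in> A \<Longrightarrow> AE s in P N.
        \<bar>sample_mean qs u (\<lambda>x. \<omega> x * f x) N s - (\<integral>x. \<omega> x * f x \<partial>product_law qs)\<bar>
          \<le> K1 * (ln (real N) ^ (CARD('d) - 1) / real N)"
      using integration_error_rate[of qs, OF qs rqmc b2 m2] by blast
    show "Lp_rate p A P err (\<lambda>N. 1 / real N * ln (real N) ^ (CARD('d) - 1))"
      unfolding err
    \<comment> \<open>Both errors are bounded deterministically here, so the constant weight 1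
      serves; its sample mean is 1 for positive \<open>N\<close>.\<close>
    proof (rule snis_Lp_rate[of qs, OF qs rqmc \<omega>b \<omega>0 \<omega>_int(1) \<omega>_pos f_cont p, where W="\<lambda>_. 1" and ?K1.0=K1 and ?K2.0=K2])
      show "0 \<le> 1 / real N * ln (real N) ^ (CARD('d) - 1)" for N by (cases "N = 0") auto
      show "\<forall>\<^sub>F N in sequentially. N \<in> A \<longrightarrow> (AE s in P N.
        \<bar>sample_mean qs u (\<lambda>x. \<omega> x * f x) N s - (\<integral>x. \<omega> x * f x \<partial>product_law qs)\<bar>
          \<le> K1 * (1 / real N * ln (real N) ^ (CARD('d) - 1)) * sample_mean qs u (\<lambda>_. 1) N s)"
        using eventually_gt_at_top[of 0] by eventually_elim (use K1(2) in auto)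
      show "\<forall>\<^sub>F N in sequentially. N \<in> A \<longrightarrow> (AE s in P N.
        \<bar>sample_mean qs u \<omega> N s - (\<integral>x. \<omega> x \<partial>product_law qs)\<bar>
          \<le> K2 * (1 / real N * ln (real N) ^ (CARD('d) - 1)) * sample_mean qs u (\<lambda>_. 1) N s)"
        using eventually_gt_at_top[of 0] by eventually_elim (use K2(2) in auto)
    qed (use K1(1) K2(1) in auto)
  next
    fix v p \<alpha> :: real and \<eta> :: int and \<epsilon> :: real
    assume h: "v > 1 \<and> integrable lborel (\<lambda>x. \<bar>f x\<bar> powr v * q x) \<and> 1 \<le> p \<and> p < v \<and>
        (\<forall>M>0. growth_condition M \<omega>) \<and>
        \<alpha> > 0 \<and> sub_gaussian_tail q \<eta> \<alpha> \<and> 0 \<le> M\<^sub>f \<and> M\<^sub>f < \<alpha> / p" and \<epsilon>: "0 < \<epsilon>"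
    then have p: "1 \<le> p" and \<alpha>: "0 < \<alpha>" and M: "0 \<le> M\<^sub>f" and Ma: "M\<^sub>f < \<alpha> / p"
      and tail: "sub_gaussian_tail (product_density qs) \<eta> \<alpha>"
      and growth: "\<And>M. 0 < M \<Longrightarrow> growth_condition M \<omega>" using assms(2) by auto
    \<comment> \<open>The critical rate: \<open>exp (\<beta> * (norm x)\<^sup>2)\<close> has a
      finite \<open>p\<close>-th moment for positive \<open>\<beta>\<close> below
      \<open>a\<close>.\<close>
    define a where "a = \<alpha> / p"
    have a: "0 < a" "a \<le> \<alpha>" "M\<^sub>f < a" "p * a = \<alpha>" using p \<alpha> Ma by (auto simp: a_def divide_simps)
    \<comment> \<open>The first entry gives \<open>M\<^sub>f + 3 * \<delta> \<le> a\<close>, as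
      truncation requires; the second keeps the loss \<open>3 * \<delta> / a\<close> in the exponent
      below \<open>\<epsilon>\<close>.\<close>
    define \<delta> where "\<delta> = min ((a - M\<^sub>f) / 3) (\<epsilon> * a / 4)"
    have \<delta>: "0 < \<delta>" "M\<^sub>f + 3 * \<delta> \<le> a" using a \<epsilon> by (auto simp: \<delta>_def min_def field_simps)
    have \<delta>a: "\<delta> < a" using \<delta> M by linarith
    have e: "(M\<^sub>f + 3 * \<delta>) / a < p * M\<^sub>f / \<alpha> + \<epsilon>"
    proof -
      have "3 * \<delta> \<le> 3 * (\<epsilon> * a / 4)" unfolding \<delta>_def by simp
      also have "\<dots> < \<epsilon> * a" using \<epsilon> a by simp
      finally have "3 * \<delta> / a < \<epsilon>" using a by (simp add: divide_simps)
      moreover have "M\<^sub>f / a = p * M\<^sub>f / \<alpha>" using p by (simp add: a_def)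
      ultimately show ?thesis by (simp add: add_divide_distrib)
    qed
    have exp_int: "integrable (product_law qs) (\<lambda>x. exp (\<beta> * (norm x)\<^sup>2))" if "0 < \<beta>" "\<beta> < \<alpha>" for \<beta>
      using integrable_exp_square_sub_gaussian[OF Q.prob_space_axioms tail that] .
    let ?W = "\<lambda>x :: real ^ 'd. exp ((a - \<delta>) * (norm x)\<^sup>2)"
    have W_int: "integrable (product_law qs) ?W" by (rule exp_int) (use \<delta> \<delta>a a in auto)
    \<comment> \<open>The \<open>p\<close>-th power of the weight has rate
      \<open>p * (a - \<delta>) = \<alpha> - p * \<delta>\<close>, strictly below the tail rate
      \<open>\<alpha>\<close>. This is why the weight uses \<open>a - \<delta>\<close> and not
      \<open>a\<close>.\<close>
    have Wp_int: "integrable (product_law qs) (\<lambda>x. ?W x powr p)"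
    proof -
      have "integrable (product_law qs) (\<lambda>x. exp (p * (a - \<delta>) * (norm x)\<^sup>2))"
        by (rule exp_int) (use p \<delta> \<delta>a a in \<open>auto simp: right_diff_distrib intro!: mult_strict_left_mono\<close>)
      then show ?thesis by (simp add: powr_def mult.assoc)
    qed
    \<comment> \<open>Taking the growth rate of \<open>\<omega>\<close> to be
      \<open>\<delta>\<close> gives the product with \<open>f\<close> the rate
      \<open>M\<^sub>f + \<delta>\<close>.\<close>
    obtain C1 where C1: "mixed_bound \<delta> C1 \<omega>"
      using growth_condition_imp_mixed_bound[OF growth[OF \<delta>(1)]] by blast
    have b1: "mixed_bound (M\<^sub>f + \<delta>) (2 ^ CARD('d) * C1 * C\<^sub>f) (\<lambda>x. \<omega> x * f x)"
      using mixed_bound_mult[OF C1 fb mixed_bound_nonneg[OF C1] mixed_bound_nonneg[OF fb]]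
      by (simp add: add.commute)
    \<comment> \<open>For the denominator the rate is weakened to that of the numerator, so that
      both errors have the same weight and the same power of \<open>N\<close>.\<close>
    have b2: "mixed_bound (M\<^sub>f + \<delta>) C1 \<omega>"
      by (rule mixed_bound_mono[OF C1]) (use M mixed_bound_nonneg[OF C1] in auto)
    obtain K1 where K1: "0 \<le> K1" "\<forall>\<^sub>F N in sequentially. N \<in> A \<longrightarrow> (AE s in P N.
        \<bar>sample_mean qs u (\<lambda>x. \<omega> x * f x) N s - (\<integral>x. \<omega> x * f x \<partial>product_law qs)\<bar>
          \<le> K1 * real N powr (- 1 + (p * M\<^sub>f / \<alpha> + \<epsilon>)) * sample_mean qs u ?W N s)"
      using truncated_integration_error[of qs, OF qs rqmc b1 M \<delta> W_int e] by blast
    obtain K2 where K2: "0 \<le> K2" "\<forall>\<^sub>F N in sequentially. N \<in> A \<longrightarrow> (AE s in P N.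
        \<bar>sample_mean qs u \<omega> N s - (\<integral>x. \<omega> x \<partial>product_law qs)\<bar>
          \<le> K2 * real N powr (- 1 + (p * M\<^sub>f / \<alpha> + \<epsilon>)) * sample_mean qs u ?W N s)"
      using truncated_integration_error[of qs, OF qs rqmc b2 M \<delta> W_int e] by blast
    show "Lp_rate p A P err (\<lambda>N. real N powr (- 1 + p * M\<^sub>f / \<alpha> + \<epsilon>))"
      unfolding err add.assoc
      by (rule snis_Lp_rate[of qs, OF qs rqmc \<omega>b \<omega>0 \<omega>_int(1) \<omega>_pos f_cont p _ _ Wp_int _ K1(1) K2(1) K1(2) K2(2)]) auto
  qed
qed

end
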